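(* Let $\rho_0,\rho_1$ be separable states on a finite-dimensional bipartite system $AB$ (i.e. $\rho_0,\rho_1\in\mathrm{SEP}$). Then $$R_{\mathrm m}(\rho_0,\rho_1)=R_{\mathrm c}(\rho_0,\rho_1)=P_{\mathrm{LOCC}}(\rho_0,\rho_1).$$ That is, neither an entangled catalyst nor a reusable quantum memory can increase the optimal success rate of local discrimination of two separable states beyond the optimal LOCC success probability.
   Context: All systems are finite-dimensional. A bipartite state $\rho^{AB}$ is separable if $\rho^{AB}=\sum_x p_x\,\psi_x^A\otimes\phi_x^B$ for a probability distribution $\{p_x\}$ and pure states $\psi_x^A,\phi_x^B$; $\mathrm{SEP}$ denotes the set of separable states. LOCC denotes local operations and classical communication between Alice (holding all systems labelled $A,A',\dots$) and Bob (holding $B,B',\dots$). An LOCC measurement channel is a map $\mathcal M(X)=\sum_i \mathrm{Tr}[M_iX]\,|ii\rangle\langle ii|$ where $\{M_i\}$ is a POVM implementable by an LOCC protocol. The LOCC norm is $\|X\|_{\mathrm{LOCC}}=\sup_{\mathcal M}\|\mathcal M(X)\|_1$ (supremum over LOCC measurement channels), and $P_{\mathrm{LOCC}}(\rho_0,\rho_1)=\tfrac12+\tfrac14\|\rho_0-\rho_1\|_{\mathrm{LOCC}}$ is the optimal LOCC success probability for discriminating $\rho_0,\rho_1$ given with equal priors. Also $P_{\mathrm{opt}}(\rho_0,\rho_1)=\tfrac12+\tfrac14\|\rho_0-\rho_1\|_1$. Repeated discrimination framework: $Z_1,Z_2,\dots$ are i.i.d. uniform on $\{0,1\}$; in round $j$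 Alice and Bob receive $\rho^{AB}_{Z_j}$ and output a guess $Y_j\in\{0,1\}$; $X_j=1$ if $Y_j=Z_j$ and $X_j=0$ otherwise; $S_n=\sum_{j=1}^n X_j$. A rate $r\in[0,1]$ is achievable by a protocol if for every $\varepsilon>0$ and every $m>0$ there exists $n\ge m$ with $\Pr(S_n\ge rn)\ge 1-\varepsilon$. Memory-assisted protocols: Alice and Bob share an auxiliary finite-dimensional system $A'B'$ (the memory) initially in some state $\mu_1^{A'B'}$. In round $j$ they apply an LOCC protocol (which may depend on all classical outcomes they obtained in earlier rounds, but not on the $Z$'s) to $\rho_{Z_j}^{AB}\otimes\mu_j^{A'B'}$, producing the guess $Y_j$ and leaving the memory in a (outcome-dependent) state $\mu_{j+1}^{A'B'}$ used in the next round. $R_{\mathrm m}(\rho_0,\rho_1)$ is the supremum of achievable rates over all memory dimensions, initial memory states and such protocols. Catalytic protocols: Alice and Bob share a catalyst state $\tau^{A'B'}$ and use an LOCC channel $\Lambda$ on $AA'|BB'$ satisfying $\Lambda(\rho_i^{AB}\otimes\tau^{A'B'})=\sigma_i^{AB}\otimes\tau^{A'B'}$ for $i=0,1$ (for some states $\sigma_0,\sigma_1$), followed by an LOCC measurement on $AB$ producing the guess; in each round the same procedure is applied with the returned catalyst. $R_{\mathrm c}(\rho_0,\rho_1)$ is the supremum of achievable rates over all such catalysts $\tau$, channels $\Lambda$ and LOCC measurements. *)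

theory Defs
  imports Complex_Main "Jordan_Normal_Form.Schur_Decomposition"
begin

abbreviation adj :: "complex mat \<Rightarrow> complex mat" where
  "adj A \<equiv> mat_adjoint A"

definition mtrace :: "complex mat \<Rightarrow> complex" where
  "mtrace A = (\<Sum>i<dim_row A. A $$ (i, i))"

definition msum :: "nat \<Rightarrow> nat \<Rightarrow> complex mat list \<Rightarrow> complex mat" where
  "msum r c Ms = foldr (+) Ms (0\<^sub>m r c)"

definition kron :: "complex mat \<Rightarrow> complex mat \<Rightarrow> complex mat" where
  "kron A B = mat (dim_row A * dim_row B) (dim_col A * dim_col B)
     (\<lambda>(r, c). A $$ (r div dim_row B, c div dim_col B) * B $$ (r mod dim_row B, c mod dim_col B))"

definition psd :: "nat \<Rightarrow> complex mat \<Rightarrow> bool" where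
  "psd n A \<longleftrightarrow> A \<in> carrier_mat n n \<and> A = adj A \<and>
     (\<forall>v. dim_vec v = n \<longrightarrow> Im (conjugate v \<bullet> (A *\<^sub>v v)) = 0 \<and> 0 \<le> Re (conjugate v \<bullet> (A *\<^sub>v v)))"

definition density :: "nat \<Rightarrow> complex mat \<Rightarrow> bool" where
  "density n \<rho> \<longleftrightarrow> psd n \<rho> \<and> mtrace \<rho> = 1"

definition proj :: "complex vec \<Rightarrow> complex mat" where
  "proj \<psi> = mat (dim_vec \<psi>) (dim_vec \<psi>) (\<lambda>(i, j). \<psi> $ i * cnj (\<psi> $ j))"

text \<open>A bipartite system AB with local dimensions dA, dB lives on C^(dA*dB),
  basis index a * dB + b.  Separable states (finite convex combinations of
  products of pure states; by Caratheodory this is the usual SEP in finite dimension).\<close>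
definition SEP :: "nat \<Rightarrow> nat \<Rightarrow> complex mat \<Rightarrow> bool" where
  "SEP dA dB \<rho> \<longleftrightarrow> (\<exists>ps :: (real \<times> complex vec \<times> complex vec) list.
     (\<forall>(p, \<psi>, \<phi>) \<in> set ps. 0 \<le> p \<and> dim_vec \<psi> = dA \<and> dim_vec \<phi> = dB \<and>
         conjugate \<psi> \<bullet> \<psi> = 1 \<and> conjugate \<phi> \<bullet> \<phi> = 1) \<and>
     (\<Sum>(p, \<psi>, \<phi>) \<leftarrow> ps. p) = 1 \<and>
     \<rho> = msum (dA * dB) (dA * dB)
            (map (\<lambda>(p, \<psi>, \<phi>). complex_of_real p \<cdot>\<^sub>m kron (proj \<psi>) (proj \<phi>)) ps))"

text \<open>Tensor product of an operator X : AB -> A1B1 (in-dims iA, iB, out-dims oA, oB)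
  with an operator Y : A'B' -> A1'B1' (in-dims iA', iB', out-dims oA', oB'),
  arranged as an operator on the bipartition (A A') | (B B'), i.e. with basis
  index ((a * dA' + a') * (dB * dB') + (b * dB' + b')).\<close>
definition btensor :: "nat \<Rightarrow> nat \<Rightarrow> nat \<Rightarrow> nat \<Rightarrow> nat \<Rightarrow> nat \<Rightarrow> nat \<Rightarrow> nat \<Rightarrow>
    complex mat \<Rightarrow> complex mat \<Rightarrow> complex mat" where
  "btensor oA oB iA iB oA' oB' iA' iB' X Y =
     mat (oA * oA' * (oB * oB')) (iA * iA' * (iB * iB'))
       (\<lambda>(r, c).
          let ra = r div (oB * oB'); rb = r mod (oB * oB');
              a = ra div oA'; a' = ra mod oA'; b = rb div oB'; b' = rb mod oB';
              ca = c div (iB * iB'); cb = c mod (iB * iB');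
              e = ca div iA'; e' = ca mod iA'; f = cb div iB'; f' = cb mod iB'
          in X $$ (a * oB + b, e * iB + f) * Y $$ (a' * oB' + b', e' * iB' + f'))"

abbreviation bstate :: "nat \<Rightarrow> nat \<Rightarrow> nat \<Rightarrow> nat \<Rightarrow> complex mat \<Rightarrow> complex mat \<Rightarrow> complex mat" where
  "bstate dA dB dA' dB' \<rho> \<mu> \<equiv> btensor dA dB dA dB dA' dB' dA' dB' \<rho> \<mu>"

text \<open>An instrument with outcomes in 'a is represented by a finite list of pairs
  (outcome x, Kraus operator K); the CP map for outcome x is
  X \<mapsto> sum over pairs (x,K) of K X K^dagger.
  LOCC dA dB dA2 dB2 L: L is an (finite-round) LOCC instrument from the bipartite
  system with local input dimensions dA | dB to local output dimensions dA2 | dB2.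
  In each round one party performs a local instrument (Kraus operators may change
  its local dimension), broadcasts the classical outcome i, and the remaining
  protocol may depend on i.  The final outcome label is any function of the
  transcript (several leaves may carry the same label).\<close>
inductive LOCC :: "nat \<Rightarrow> nat \<Rightarrow> nat \<Rightarrow> nat \<Rightarrow> ('a \<times> complex mat) list \<Rightarrow> bool" where
  finish: "LOCC dA dB dA dB [(x, 1\<^sub>m (dA * dB))]"
| alice: "\<lbrakk> \<forall>(i, E) \<in> set (Es :: (nat \<times> complex mat) list). E \<in> carrier_mat dA2 dA1;
           msum dA1 dA1 (map (\<lambda>(i, E). adj E * E) Es) = 1\<^sub>m dA1;
           \<forall>i \<in> fst ` set Es. LOCC dA2 dB dA3 dB3 (C i) \<rbrakk>
   \<Longrightarrow> LOCC dA1 dB dA3 dB3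
         (concat (map (\<lambda>(i, E). map (\<lambda>(x, K). (x, K * kron E (1\<^sub>m dB))) (C i)) Es))"
| bob: "\<lbrakk> \<forall>(i, F) \<in> set (Fs :: (nat \<times> complex mat) list). F \<in> carrier_mat dB2 dB1;
           msum dB1 dB1 (map (\<lambda>(i, F). adj F * F) Fs) = 1\<^sub>m dB1;
           \<forall>i \<in> fst ` set Fs. LOCC dA dB2 dA3 dB3 (C i) \<rbrakk>
   \<Longrightarrow> LOCC dA dB1 dA3 dB3
         (concat (map (\<lambda>(i, F). map (\<lambda>(x, K). (x, K * kron (1\<^sub>m dA) F)) (C i)) Fs))"

definition chan :: "nat \<Rightarrow> ('a \<times> complex mat) list \<Rightarrow> complex mat \<Rightarrow> complex mat" where
  "chan n L X = msum n n (map (\<lambda>(x, K). K * X * adj K) L)"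

definition povm :: "nat \<Rightarrow> ('a \<times> complex mat) list \<Rightarrow> 'a \<Rightarrow> complex mat" where
  "povm n L x = msum n n (map (\<lambda>(y, K). adj K * K) (filter (\<lambda>(y, K). y = x) L))"

text \<open>LOCC measurements on AB: LOCC instruments with trivial output (dims 1 | 1).
  The LOCC norm: sup over LOCC measurement channels M of
  || sum_i Tr[M_i X] |ii><ii| ||_1 = sum_i |Tr[M_i X]|.\<close>
definition LOCC_norm :: "nat \<Rightarrow> nat \<Rightarrow> complex mat \<Rightarrow> real" where
  "LOCC_norm dA dB X = Sup {(\<Sum>x \<in> fst ` set L. cmod (mtrace (povm (dA * dB) L x * X))) |
                              L :: (nat \<times> complex mat) list. LOCC dA dB 1 1 L}"

definition P_LOCC :: "nat \<Rightarrow> nat \<Rightarrow> complex mat \<Rightarrow> complex mat \<Rightarrow> real" where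
  "P_LOCC dA dB \<rho>0 \<rho>1 = 1/2 + 1/4 * LOCC_norm dA dB (\<rho>0 - \<rho>1)"

text \<open>Outcomes of a round: (guess Y_j, additional classical data).  Z_j = True means
  rho_1 was sent.  A round strategy L maps the classical history (all earlier
  outcomes) to an instrument from AA'|BB' to the memory A'B'.
  disc_run ... thr m h sigma c: probability (weighted by the unnormalised memory
  state sigma after history h, with c correct guesses so far) that after m further
  rounds the total number of correct guesses is >= thr.  Since this quantity is
  linear in sigma, outcomes can be expanded Kraus operator by Kraus operator.\<close>
primrec disc_run :: "nat \<Rightarrow> nat \<Rightarrow> nat \<Rightarrow> nat \<Rightarrow> complex mat \<Rightarrow> complex mat \<Rightarrow>
    ((bool \<times> nat) list \<Rightarrow> ((bool \<times> nat) \<times> complex mat) list) \<Rightarrow> real \<Rightarrow>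
    nat \<Rightarrow> (bool \<times> nat) list \<Rightarrow> complex mat \<Rightarrow> nat \<Rightarrow> real" where
  "disc_run dA dB dA' dB' \<rho>0 \<rho>1 L thr 0 h \<sigma> c = (if thr \<le> real c then Re (mtrace \<sigma>) else 0)"
| "disc_run dA dB dA' dB' \<rho>0 \<rho>1 L thr (Suc m) h \<sigma> c =
     (\<Sum>z \<in> (UNIV :: bool set). 1/2 *
        (\<Sum>(x, K) \<leftarrow> L h.
           disc_run dA dB dA' dB' \<rho>0 \<rho>1 L thr m (h @ [x])
             (K * bstate dA dB dA' dB' (if z then \<rho>1 else \<rho>0) \<sigma> * adj K)
             (if fst x = z then Suc c else c)))"

definition succ_prob :: "nat \<Rightarrow> nat \<Rightarrow> nat \<Rightarrow> nat \<Rightarrow> complex mat \<Rightarrow> complex mat \<Rightarrow>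
    ((bool \<times> nat) list \<Rightarrow> ((bool \<times> nat) \<times> complex mat) list) \<Rightarrow> complex mat \<Rightarrow> real \<Rightarrow> nat \<Rightarrow> real" where
  "succ_prob dA dB dA' dB' \<rho>0 \<rho>1 L \<mu> r n = disc_run dA dB dA' dB' \<rho>0 \<rho>1 L (r * real n) n [] \<mu> 0"

definition achievable :: "(nat \<Rightarrow> real) \<Rightarrow> bool" where
  "achievable P \<longleftrightarrow> (\<forall>\<epsilon>>0. \<forall>m. \<exists>n\<ge>m. P n \<ge> 1 - \<epsilon>)"

definition R_m :: "nat \<Rightarrow> nat \<Rightarrow> complex mat \<Rightarrow> complex mat \<Rightarrow> real" where
  "R_m dA dB \<rho>0 \<rho>1 = Sup {r. 0 \<le> r \<and> r \<le> 1 \<and>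
     (\<exists>dA' dB' \<mu> L. 0 < dA' \<and> 0 < dB' \<and> density (dA' * dB') \<mu> \<and>
        (\<forall>h. LOCC (dA * dA') (dB * dB') dA' dB' (L h)) \<and>
        achievable (succ_prob dA dB dA' dB' \<rho>0 \<rho>1 L \<mu> r))}"

text \<open>Catalytic round: LOCC channel Lam on AA'|BB' (output AA'|BB'), then LOCC
  measurement M on AB (tensored with the identity on A'B'); A'B' is kept.\<close>
definition cat_round :: "nat \<Rightarrow> nat \<Rightarrow> nat \<Rightarrow> nat \<Rightarrow> (nat \<times> complex mat) list \<Rightarrow>
    ((bool \<times> nat) \<times> complex mat) list \<Rightarrow> ((bool \<times> nat) \<times> complex mat) list" where
  "cat_round dA dB dA' dB' Lam M =
     concat (map (\<lambda>(_, K). map (\<lambda>(x, Km).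
        (x, btensor 1 1 dA dB dA' dB' dA' dB' Km (1\<^sub>m (dA' * dB')) * K)) M) Lam)"

definition R_c :: "nat \<Rightarrow> nat \<Rightarrow> complex mat \<Rightarrow> complex mat \<Rightarrow> real" where
  "R_c dA dB \<rho>0 \<rho>1 = Sup {r. 0 \<le> r \<and> r \<le> 1 \<and>
     (\<exists>dA' dB' \<tau> (Lam :: (nat \<times> complex mat) list) \<sigma>0 \<sigma>1 M.
        0 < dA' \<and> 0 < dB' \<and> density (dA' * dB') \<tau> \<and>
        LOCC (dA * dA') (dB * dB') (dA * dA') (dB * dB') Lam \<and>
        density (dA * dB) \<sigma>0 \<and> density (dA * dB) \<sigma>1 \<and>
        chan (dA * dA' * (dB * dB')) Lam (bstate dA dB dA' dB' \<rho>0 \<tau>) = bstate dA dB dA' dB' \<sigma>0 \<tau> \<and>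
        chan (dA * dA' * (dB * dB')) Lam (bstate dA dB dA' dB' \<rho>1 \<tau>) = bstate dA dB dA' dB' \<sigma>1 \<tau> \<and>
        LOCC dA dB 1 1 M \<and>
        achievable (succ_prob dA dB dA' dB' \<rho>0 \<rho>1 (\<lambda>_. cat_round dA dB dA' dB' Lam M) \<tau> r))}"

end

(*
  The uniform memory dominates every density operator up to the factor D = dim A'B', and
  it is separable. So the success probability of a memory-assisted protocol is at most D times
  that of the same protocol started in a separable memory. A separable memory stays separable
  when separable states are received, and on a product memory a round is an LOCC
  measurement of AB alone: prepare the memory locally, run the round, discard the output.
  Hence each guess is correct with conditional probability at most P_LOCC, and a Chernoff bound
  makes the probability of exceeding the rate P_LOCC exponentially small, which absorbs D.
  Conversely the trivial catalyst together with the law of large numbers (again by Chernoff) attains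
  every rate below P_LOCC, and catalytic protocols are particular memory-assisted ones.
*)

theory Submission
  imports Defs
begin

text \<open>An entangled memory can genuinely help in a single round, for instance by teleporting
  one party's share to the other, so no bound on an individual round survives its presence. The
  comparison with a separable memory is therefore made once, for the whole run: the success
  probability is additive in the initial memory and nonnegative on positive semidefinite operators,
  and \<open>1 - \<mu>\<close> is positive semidefinite, so the identity in place of
  \<open>\<mu>\<close> can only do better. Entanglement thus costs a factor that does not grow with
  the number of rounds.

  A run is expanded Kraus operator by Kraus operator with unnormalised memory operators. Conditional
  probabilities never appear: every estimate is homogeneous, a constant times
  \<open>Re (mtrace \<sigma>)\<close>, and is proved on a cone that one round maps into itself,
  namely \<open>sep_cone\<close> for the upper tail and \<open>psd 1\<close> for the lower tail. One
  exponential moment estimate, with a parameter \<open>t\<close> of either sign, serves both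
  tails.\<close>

section \<open>Matrices, adjoints and traces\<close>

lemma adjoint_dim [simp]: "dim_row (adj A) = dim_col A" "dim_col (adj A) = dim_row A"
  by (auto simp: mat_adjoint_def)

lemma adjoint_index [simp]: "i < dim_col A \<Longrightarrow> j < dim_row A \<Longrightarrow> adj A $$ (i, j) = cnj (A $$ (j, i))"
  by (auto simp: mat_adjoint_def mat_of_rows_def)

lemma adjoint_carrier [simp]: "A \<in> carrier_mat n m \<Longrightarrow> adj A \<in> carrier_mat m n"
  by (auto intro!: carrier_matI)

lemma index_mult_sum:
  fixes A B :: "'a :: comm_semiring_1 mat"
  assumes "i < dim_row A" "j < dim_col B" "dim_col A = dim_row B"
  shows "(A * B) $$ (i, j) = (\<Sum>k<dim_col A. A $$ (i, k) * B $$ (k, j))"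
  using assms by (simp add: scalar_prod_def lessThan_atLeast0)

lemma adjoint_mult: "dim_col A = dim_row B \<Longrightarrow> adj (A * B) = adj B * adj A"
  by (rule eq_matI) (auto simp: index_mult_sum mult.commute simp del: index_mult_mat(1))

lemma adjoint_one [simp]: "adj (1\<^sub>m n) = 1\<^sub>m n"
  by (rule eq_matI) auto

lemma adjoint_adjoint [simp]: "adj (adj A) = A"
  by (rule eq_matI) auto

lemma adjoint_add: "A \<in> carrier_mat n m \<Longrightarrow> B \<in> carrier_mat n m \<Longrightarrow> adj (A + B) = adj A + adj B"
  by (rule eq_matI) auto

lemma adjoint_minus: "A \<in> carrier_mat n m \<Longrightarrow> B \<in> carrier_mat n m \<Longrightarrow> adj (A - B) = adj A - adj B"
  by (rule eq_matI) auto

lemma adjoint_smult: "adj (c \<cdot>\<^sub>m A) = cnj c \<cdot>\<^sub>m adj A"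
  by (rule eq_matI) auto

lemma mtrace_add: "A \<in> carrier_mat n n \<Longrightarrow> B \<in> carrier_mat n n \<Longrightarrow> mtrace (A + B) = mtrace A + mtrace B"
  by (auto simp: mtrace_def sum.distrib)

lemma mtrace_minus: "A \<in> carrier_mat n n \<Longrightarrow> B \<in> carrier_mat n n \<Longrightarrow> mtrace (A - B) = mtrace A - mtrace B"
  by (auto simp: mtrace_def sum_subtractf)

lemma mtrace_smult: "A \<in> carrier_mat n n \<Longrightarrow> mtrace (c \<cdot>\<^sub>m A) = c * mtrace A"
  by (auto simp: mtrace_def sum_distrib_left)

lemma mtrace_zero [simp]: "mtrace (0\<^sub>m n n) = 0"
  by (auto simp: mtrace_def)

lemma mtrace_comm:
  assumes "A \<in> carrier_mat n m" "B \<in> carrier_mat m n"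
  shows "mtrace (A * B) = mtrace (B * A)"
proof -
  have "mtrace (A * B) = (\<Sum>i<n. \<Sum>k<m. A $$ (i, k) * B $$ (k, i))"
    using assms by (simp add: mtrace_def index_mult_sum del: index_mult_mat(1))
  also have "\<dots> = (\<Sum>k<m. \<Sum>i<n. B $$ (k, i) * A $$ (i, k))"
    by (subst sum.swap) (simp add: mult.commute)
  also have "\<dots> = mtrace (B * A)"
    using assms by (simp add: mtrace_def index_mult_sum del: index_mult_mat(1))
  finally show ?thesis .
qed

lemma msum_simps [simp]:
  "msum r c [] = 0\<^sub>m r c" "msum r c (M # Ms) = M + msum r c Ms"
  by (auto simp: msum_def)

lemma msum_carrier:
  "(\<And>M. M \<in> set Ms \<Longrightarrow> M \<in> carrier_mat r c) \<Longrightarrow> msum r c Ms \<in> carrier_mat r c"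
  by (induction Ms) auto

lemma mult_msum_right:
  assumes "A \<in> carrier_mat c n" "\<And>M. M \<in> set Ms \<Longrightarrow> M \<in> carrier_mat r c"
  shows "msum r c Ms * A = msum r n (map (\<lambda>M. M * A) Ms)"
  using assms(2)
proof (induction Ms)
  case (Cons M Ms)
  have "msum r c Ms \<in> carrier_mat r c" using Cons.prems by (intro msum_carrier) auto
  then show ?case using Cons assms(1) by (simp add: add_mult_distrib_mat[where nr=r and n=c and nc=n])
qed (use assms(1) in simp)

lemma mtrace_msum:
  assumes "\<And>M. M \<in> set Ms \<Longrightarrow> M \<in> carrier_mat n n"
  shows "mtrace (msum n n Ms) = sum_list (map mtrace Ms)"
  using assms
proof (induction Ms)
  case (Cons M Ms)
  have "msum n n Ms \<in> carrier_mat n n" using Cons.prems by (intro msum_carrier) auto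
  then show ?case using Cons by (simp add: mtrace_add[where n=n])
qed simp

section \<open>Tensor products\<close>

lemma sum_lessThan_mult:
  fixes m n :: nat
  shows "(\<Sum>k<m * n. g k) = (\<Sum>i<m. \<Sum>j<n. g (i * n + j))"
proof -
  have "(\<Sum>k<m * n. g k) = (\<Sum>i<m. sum g {i * n..<i * n + n})"
    by (rule sum.nat_group[symmetric])
  also have "\<dots> = (\<Sum>i<m. \<Sum>j<n. g (i * n + j))"
  proof (rule sum.cong[OF refl])
    fix i
    show "sum g {i * n..<i * n + n} = (\<Sum>j<n. g (i * n + j))"
      using sum.shift_bounds_nat_ivl[of g 0 "i * n" n] by (simp add: lessThan_atLeast0 add.commute)
  qed
  finally show ?thesis .
qed

lemma lessThan_mult_div: "(r::nat) < m * n \<Longrightarrow> r div n < m"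
  by (metis less_mult_imp_div_less)

lemma lessThan_mult_mod: "(r::nat) < m * n \<Longrightarrow> r mod n < n"
  by (metis less_nat_zero_code mod_less_divisor mult_0_right neq0_conv)

lemma mult_add_lessThan: "(i::nat) < m \<Longrightarrow> j < n \<Longrightarrow> i * n + j < m * n"
proof -
  assume "i < m" "j < n"
  then have "i * n + j < Suc i * n" by simp
  also have "\<dots> \<le> m * n" using \<open>i < m\<close> by (intro mult_right_mono) auto
  finally show ?thesis .
qed

lemma kron_dim [simp]:
  "dim_row (kron A B) = dim_row A * dim_row B" "dim_col (kron A B) = dim_col A * dim_col B"
  by (auto simp: kron_def)

lemma kron_carrier [simp]:
  "A \<in> carrier_mat a b \<Longrightarrow> B \<in> carrier_mat c d \<Longrightarrow> kron A B \<in> carrier_mat (a * c) (b * d)"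
  by (auto simp: kron_def)

lemma index_kron:
  assumes "r < dim_row A * dim_row B" "c < dim_col A * dim_col B"
  shows "kron A B $$ (r, c) =
    A $$ (r div dim_row B, c div dim_col B) * B $$ (r mod dim_row B, c mod dim_col B)"
  using assms by (simp add: kron_def)

lemma kron_mult:
  assumes "dim_col A = dim_row C" "dim_col B = dim_row D"
  shows "kron A B * kron C D = kron (A * C) (B * D)"
proof (rule eq_matI)
  fix r c assume "r < dim_row (kron (A * C) (B * D))" "c < dim_col (kron (A * C) (B * D))"
  then have r: "r < dim_row A * dim_row B" and c: "c < dim_col C * dim_col D" by auto
  have "(kron A B * kron C D) $$ (r, c) =
      (\<Sum>k<dim_col A * dim_col B. kron A B $$ (r, k) * kron C D $$ (k, c))"
    using r c assms by (simp add: index_mult_sum del: index_mult_mat(1))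
  also have "\<dots> = (\<Sum>i<dim_col A. \<Sum>j<dim_col B.
      (A $$ (r div dim_row B, i) * C $$ (i, c div dim_col D)) *
      (B $$ (r mod dim_row B, j) * D $$ (j, c mod dim_col D)))"
    using r c assms
    by (subst sum_lessThan_mult) (auto intro!: sum.cong simp: index_kron mult_add_lessThan mult_ac)
  also have "\<dots> = kron (A * C) (B * D) $$ (r, c)"
    using r c assms lessThan_mult_div[OF r] lessThan_mult_mod[OF r] lessThan_mult_div[OF c] lessThan_mult_mod[OF c]
    by (simp add: index_kron index_mult_sum sum_product del: index_mult_mat(1))
  finally show "(kron A B * kron C D) $$ (r, c) = kron (A * C) (B * D) $$ (r, c)" .
qed auto

lemma adjoint_kron: "adj (kron A B) = kron (adj A) (adj B)"
  by (rule eq_matI)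
     (auto simp: index_kron lessThan_mult_div lessThan_mult_mod)

lemma kron_one [simp]: "kron (1\<^sub>m a) (1\<^sub>m b) = 1\<^sub>m (a * b)"
proof (rule eq_matI)
  fix i j assume "i < dim_row (1\<^sub>m (a * b))" "j < dim_col (1\<^sub>m (a * b))"
  then have i: "i < a * b" and j: "j < a * b" by auto
  have "i = j \<longleftrightarrow> i div b = j div b \<and> i mod b = j mod b"
    by (metis div_mult_mod_eq)
  then show "kron (1\<^sub>m a) (1\<^sub>m b) $$ (i, j) = 1\<^sub>m (a * b) $$ (i, j)"
    using i j lessThan_mult_div[OF i] lessThan_mult_mod[OF i] lessThan_mult_div[OF j] lessThan_mult_mod[OF j]
    by (auto simp: index_kron)
qed auto

lemma kron_smult: "kron (c \<cdot>\<^sub>m A) (d \<cdot>\<^sub>m B) = (c * d) \<cdot>\<^sub>m kron A B"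
  by (rule eq_matI)
     (auto simp: index_kron lessThan_mult_div lessThan_mult_mod)

lemma kron_add_left:
  "A \<in> carrier_mat a b \<Longrightarrow> A' \<in> carrier_mat a b \<Longrightarrow> kron (A + A') B = kron A B + kron A' B"
  by (rule eq_matI) (auto simp: index_kron lessThan_mult_div lessThan_mult_mod distrib_right)

lemma kron_add_right:
  "B \<in> carrier_mat a b \<Longrightarrow> B' \<in> carrier_mat a b \<Longrightarrow> kron A (B + B') = kron A B + kron A B'"
  by (rule eq_matI) (auto simp: index_kron lessThan_mult_div lessThan_mult_mod distrib_left)

lemma kron_msum_left:
  assumes "\<And>M. M \<in> set Ms \<Longrightarrow> M \<in> carrier_mat a b" and "B \<in> carrier_mat c d"
  shows "kron (msum a b Ms) B = msum (a * c) (b * d) (map (\<lambda>M. kron M B) Ms)"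
  using assms(1)
proof (induction Ms)
  case Nil
  then show ?case using assms(2)
    by (intro eq_matI) (auto simp: index_kron lessThan_mult_div lessThan_mult_mod)
next
  case (Cons M Ms)
  have "msum a b Ms \<in> carrier_mat a b" using Cons.prems by (intro msum_carrier) auto
  then show ?case using Cons by (simp add: kron_add_left[where a=a and b=b])
qed

lemma kron_msum_right:
  assumes "\<And>M. M \<in> set Ms \<Longrightarrow> M \<in> carrier_mat a b" and "B \<in> carrier_mat c d"
  shows "kron B (msum a b Ms) = msum (c * a) (d * b) (map (\<lambda>M. kron B M) Ms)"
  using assms(1)
proof (induction Ms)
  case Nil
  then show ?case using assms(2)
    by (intro eq_matI) (auto simp: index_kron lessThan_mult_div lessThan_mult_mod)
next
  case (Cons M Ms)
  have "msum a b Ms \<in> carrier_mat a b" using Cons.prems by (intro msum_carrier) auto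
  then show ?case using Cons by (simp add: kron_add_right[where a=a and b=b])
qed

text \<open>An index of \<open>AA'|BB'\<close> determines an index of \<open>AB\<close> and an index of \<open>A'B'\<close>;
  in terms of these, \<^const>\<open>btensor\<close> is the ordinary tensor product.\<close>

definition outer_index :: "nat \<Rightarrow> nat \<Rightarrow> nat \<Rightarrow> nat \<Rightarrow> nat" where
  "outer_index B a' b' k = (k div (B * b')) div a' * B + (k mod (B * b')) div b'"

definition inner_index :: "nat \<Rightarrow> nat \<Rightarrow> nat \<Rightarrow> nat \<Rightarrow> nat" where
  "inner_index B a' b' k = (k div (B * b')) mod a' * b' + (k mod (B * b')) mod b'"

lemma composite_index_bounds:
  fixes k :: nat
  assumes "k < A * a' * (B * b')"
  shows "(k div (B * b')) div a' < A" "(k div (B * b')) mod a' < a'"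
    "(k mod (B * b')) div b' < B" "(k mod (B * b')) mod b' < b'"
  using lessThan_mult_div[OF assms] lessThan_mult_mod[OF assms]
  by (meson lessThan_mult_div lessThan_mult_mod)+

lemma outer_index_less: "k < A * a' * (B * b') \<Longrightarrow> outer_index B a' b' k < A * B"
  unfolding outer_index_def using composite_index_bounds[of k A a' B b'] by (auto intro: mult_add_lessThan)

lemma inner_index_less: "k < A * a' * (B * b') \<Longrightarrow> inner_index B a' b' k < a' * b'"
  unfolding inner_index_def using composite_index_bounds[of k A a' B b'] by (auto intro: mult_add_lessThan)

text \<open>The index \<open>k\<close> has four digits a, a', b, b', and the pair of outer and inner
  index regroups them as (a, b) and (a', b'); exchanging the two middle sums does this.\<close>

lemma sum_composite_index:
  "(\<Sum>k<A * a' * (B * b'). f (outer_index B a' b' k) (inner_index B a' b' k)) =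
   (\<Sum>u<A * B. \<Sum>v<a' * b'. f u v)"
proof -
  have "(\<Sum>k<A * a' * (B * b'). f (outer_index B a' b' k) (inner_index B a' b' k)) =
     (\<Sum>a<A. \<Sum>a2<a'. \<Sum>b<B. \<Sum>b2<b'. f (a * B + b) (a2 * b' + b2))"
    by (simp only: sum_lessThan_mult, intro sum.cong refl)
      (simp add: outer_index_def inner_index_def mult_add_lessThan)
  also have "\<dots> = (\<Sum>a<A. \<Sum>b<B. \<Sum>a2<a'. \<Sum>b2<b'. f (a * B + b) (a2 * b' + b2))"
    by (intro sum.cong[OF refl] sum.swap)
  also have "\<dots> = (\<Sum>u<A * B. \<Sum>v<a' * b'. f u v)"
    by (simp only: sum_lessThan_mult)
  finally show ?thesis .
qed

section \<open>The tensor product arranged along the cut AA'|BB'\<close>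

lemma btensor_dim [simp]:
  "dim_row (btensor oA oB iA iB oA' oB' iA' iB' X Y) = oA * oA' * (oB * oB')"
  "dim_col (btensor oA oB iA iB oA' oB' iA' iB' X Y) = iA * iA' * (iB * iB')"
  by (auto simp: btensor_def)

lemma btensor_carrier [simp]:
  "btensor oA oB iA iB oA' oB' iA' iB' X Y \<in> carrier_mat (oA * oA' * (oB * oB')) (iA * iA' * (iB * iB'))"
  by (auto simp: btensor_def)

lemma index_btensor:
  assumes "r < oA * oA' * (oB * oB')" "c < iA * iA' * (iB * iB')"
  shows "btensor oA oB iA iB oA' oB' iA' iB' X Y $$ (r, c) =
    X $$ (outer_index oB oA' oB' r, outer_index iB iA' iB' c) *
    Y $$ (inner_index oB oA' oB' r, inner_index iB iA' iB' c)"
  using assms by (simp add: btensor_def Let_def outer_index_def inner_index_def)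

text \<open>By \<open>sum_composite_index\<close> the sum over the intermediate index factorises
  into one sum for each system. The intermediate dimensions are independent of the outer ones, since
  Kraus operators may change local dimensions and a memory may be factored through dimensions
  1|1.\<close>

lemma btensor_mult:
  assumes "X \<in> carrier_mat (oA * oB) (mA * mB)" "X' \<in> carrier_mat (mA * mB) (iA * iB)"
    "Y \<in> carrier_mat (oA' * oB') (mA' * mB')" "Y' \<in> carrier_mat (mA' * mB') (iA' * iB')"
  shows "btensor oA oB mA mB oA' oB' mA' mB' X Y * btensor mA mB iA iB mA' mB' iA' iB' X' Y' =
    btensor oA oB iA iB oA' oB' iA' iB' (X * X') (Y * Y')"
proof (rule eq_matI)
  fix r c
  assume "r < dim_row (btensor oA oB iA iB oA' oB' iA' iB' (X * X') (Y * Y'))"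
    "c < dim_col (btensor oA oB iA iB oA' oB' iA' iB' (X * X') (Y * Y'))"
  then have rc: "r < oA * oA' * (oB * oB')" "c < iA * iA' * (iB * iB')" by auto
  define r1 r2 c1 c2 where d: "r1 = outer_index oB oA' oB' r" "r2 = inner_index oB oA' oB' r"
    "c1 = outer_index iB iA' iB' c" "c2 = inner_index iB iA' iB' c"
  have b: "r1 < oA * oB" "r2 < oA' * oB'" "c1 < iA * iB" "c2 < iA' * iB'"
    unfolding d using rc by (auto intro: outer_index_less inner_index_less)
  have "(btensor oA oB mA mB oA' oB' mA' mB' X Y * btensor mA mB iA iB mA' mB' iA' iB' X' Y') $$ (r, c) =
      (\<Sum>k<mA * mA' * (mB * mB'). (\<lambda>u v. (X $$ (r1, u) * X' $$ (u, c1)) * (Y $$ (r2, v) * Y' $$ (v, c2)))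
        (outer_index mB mA' mB' k) (inner_index mB mA' mB' k))"
    using rc by (subst index_mult_sum) (auto intro!: sum.cong simp: index_btensor d mult_ac)
  also have "\<dots> = (\<Sum>u<mA * mB. \<Sum>v<mA' * mB'. (X $$ (r1, u) * X' $$ (u, c1)) * (Y $$ (r2, v) * Y' $$ (v, c2)))"
    by (rule sum_composite_index)
  also have "\<dots> = (X * X') $$ (r1, c1) * (Y * Y') $$ (r2, c2)"
    using assms b by (simp add: sum_product index_mult_sum del: index_mult_mat(1))
  also have "\<dots> = btensor oA oB iA iB oA' oB' iA' iB' (X * X') (Y * Y') $$ (r, c)"
    using rc by (simp add: index_btensor d del: index_mult_mat(1))
  finally show "(btensor oA oB mA mB oA' oB' mA' mB' X Y * btensor mA mB iA iB mA' mB' iA' iB' X' Y') $$ (r, c) =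
    btensor oA oB iA iB oA' oB' iA' iB' (X * X') (Y * Y') $$ (r, c)" .
qed auto

lemma adjoint_btensor:
  assumes "X \<in> carrier_mat (oA * oB) (iA * iB)" "Y \<in> carrier_mat (oA' * oB') (iA' * iB')"
  shows "adj (btensor oA oB iA iB oA' oB' iA' iB' X Y) = btensor iA iB oA oB iA' iB' oA' oB' (adj X) (adj Y)"
proof (rule eq_matI)
  fix r c
  assume "r < dim_row (btensor iA iB oA oB iA' iB' oA' oB' (adj X) (adj Y))"
    "c < dim_col (btensor iA iB oA oB iA' iB' oA' oB' (adj X) (adj Y))"
  then have rc: "c < oA * oA' * (oB * oB')" "r < iA * iA' * (iB * iB')" by auto
  show "adj (btensor oA oB iA iB oA' oB' iA' iB' X Y) $$ (r, c) =
      btensor iA iB oA oB iA' iB' oA' oB' (adj X) (adj Y) $$ (r, c)"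
    using rc assms outer_index_less[OF rc(1)] inner_index_less[OF rc(1)]
      outer_index_less[OF rc(2)] inner_index_less[OF rc(2)]
    by (simp add: index_btensor)
qed auto

text \<open>Both sides have the same four factors at the digits of the indices. Regrouped in this
  way, a product across A|B tensored with a product across A'|B' is a product of an operator on AA'
  and one on BB', which is what makes it local.\<close>

lemma btensor_kron:
  assumes "P \<in> carrier_mat oA iA" "R \<in> carrier_mat oB iB" "Q \<in> carrier_mat oA' iA'" "S \<in> carrier_mat oB' iB'"
  shows "btensor oA oB iA iB oA' oB' iA' iB' (kron P R) (kron Q S) = kron (kron P Q) (kron R S)"
proof (rule eq_matI)
  fix r c assume "r < dim_row (kron (kron P Q) (kron R S))" "c < dim_col (kron (kron P Q) (kron R S))"
  then have r: "r < oA * oA' * (oB * oB')" and c: "c < iA * iA' * (iB * iB')" using assms by auto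
  note b = composite_index_bounds[OF r] composite_index_bounds[OF c]
  have "btensor oA oB iA iB oA' oB' iA' iB' (kron P R) (kron Q S) $$ (r, c) =
      (P $$ (r div (oB * oB') div oA', c div (iB * iB') div iA') *
       R $$ (r mod (oB * oB') div oB', c mod (iB * iB') div iB')) *
      (Q $$ (r div (oB * oB') mod oA', c div (iB * iB') mod iA') *
       S $$ (r mod (oB * oB') mod oB', c mod (iB * iB') mod iB'))"
    using r c assms b
    by (simp add: index_btensor outer_index_def inner_index_def index_kron mult_add_lessThan)
  also have "\<dots> = kron (kron P Q) (kron R S) $$ (r, c)"
    using r c assms lessThan_mult_div[OF r] lessThan_mult_mod[OF r] lessThan_mult_div[OF c] lessThan_mult_mod[OF c]
    by (simp add: index_kron mult_ac)
  finally show "btensor oA oB iA iB oA' oB' iA' iB' (kron P R) (kron Q S) $$ (r, c) =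
      kron (kron P Q) (kron R S) $$ (r, c)" .
qed (use assms in auto)

lemma btensor_one_right:
  assumes "X \<in> carrier_mat (oA * oB) (iA * iB)"
  shows "btensor oA oB iA iB 1 1 1 1 X (1\<^sub>m 1) = X"
  by (rule eq_matI) (use assms in \<open>auto simp: index_btensor outer_index_def inner_index_def\<close>)

lemma btensor_one_left:
  assumes "Y \<in> carrier_mat (oA' * oB') (iA' * iB')"
  shows "btensor 1 1 1 1 oA' oB' iA' iB' (1\<^sub>m 1) Y = Y"
proof (rule eq_matI)
  fix r c assume "r < dim_row Y" "c < dim_col Y"
  then have r: "r < 1 * oA' * (1 * oB')" and c: "c < 1 * iA' * (1 * iB')" using assms by auto
  have [simp]: "inner_index (Suc 0) oA' oB' r = r" "inner_index (Suc 0) iA' iB' c = c"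
    using r c by (auto simp: inner_index_def lessThan_mult_div)
  show "btensor 1 1 1 1 oA' oB' iA' iB' (1\<^sub>m 1) Y $$ (r, c) = Y $$ (r, c)"
    using r c outer_index_less[OF r] outer_index_less[OF c]
    by (simp add: index_btensor)
qed (use assms in auto)

lemma btensor_add_left:
  assumes "X \<in> carrier_mat (oA * oB) (iA * iB)" "X' \<in> carrier_mat (oA * oB) (iA * iB)"
  shows "btensor oA oB iA iB oA' oB' iA' iB' (X + X') Y =
    btensor oA oB iA iB oA' oB' iA' iB' X Y + btensor oA oB iA iB oA' oB' iA' iB' X' Y"
proof (rule eq_matI)
  let ?T = "\<lambda>X. btensor oA oB iA iB oA' oB' iA' iB' X Y"
  fix r c assume "r < dim_row (?T X + ?T X')" "c < dim_col (?T X + ?T X')"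
  then have "r < oA * oA' * (oB * oB')" "c < iA * iA' * (iB * iB')" by auto
  with outer_index_less[OF this(1)] outer_index_less[OF this(2)]
  show "?T (X + X') $$ (r, c) = (?T X + ?T X') $$ (r, c)"
    using assms by (simp add: index_btensor distrib_right)
qed auto

lemma btensor_add_right:
  assumes "Y \<in> carrier_mat (oA' * oB') (iA' * iB')" "Y' \<in> carrier_mat (oA' * oB') (iA' * iB')"
  shows "btensor oA oB iA iB oA' oB' iA' iB' X (Y + Y') =
    btensor oA oB iA iB oA' oB' iA' iB' X Y + btensor oA oB iA iB oA' oB' iA' iB' X Y'"
proof (rule eq_matI)
  let ?T = "\<lambda>Y. btensor oA oB iA iB oA' oB' iA' iB' X Y"
  fix r c assume "r < dim_row (?T Y + ?T Y')" "c < dim_col (?T Y + ?T Y')"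
  then have "r < oA * oA' * (oB * oB')" "c < iA * iA' * (iB * iB')" by auto
  with inner_index_less[OF this(1)] inner_index_less[OF this(2)]
  show "?T (Y + Y') $$ (r, c) = (?T Y + ?T Y') $$ (r, c)"
    using assms by (simp add: index_btensor distrib_left)
qed auto

lemma btensor_smult_right:
  assumes "Y \<in> carrier_mat (oA' * oB') (iA' * iB')"
  shows "btensor oA oB iA iB oA' oB' iA' iB' X (k \<cdot>\<^sub>m Y) = k \<cdot>\<^sub>m btensor oA oB iA iB oA' oB' iA' iB' X Y"
proof (rule eq_matI)
  let ?T = "\<lambda>Y. btensor oA oB iA iB oA' oB' iA' iB' X Y"
  fix r c assume "r < dim_row (k \<cdot>\<^sub>m ?T Y)" "c < dim_col (k \<cdot>\<^sub>m ?T Y)"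
  then have "r < oA * oA' * (oB * oB')" "c < iA * iA' * (iB * iB')" by auto
  with inner_index_less[OF this(1)] inner_index_less[OF this(2)]
  show "?T (k \<cdot>\<^sub>m Y) $$ (r, c) = (k \<cdot>\<^sub>m ?T Y) $$ (r, c)"
    using assms by (simp add: index_btensor)
qed auto

lemma btensor_zero_left:
  "btensor oA oB iA iB oA' oB' iA' iB' (0\<^sub>m (oA * oB) (iA * iB)) Y = 0\<^sub>m (oA * oA' * (oB * oB')) (iA * iA' * (iB * iB'))"
  by (rule eq_matI) (auto simp: index_btensor outer_index_less)

lemma btensor_zero_right:
  "btensor oA oB iA iB oA' oB' iA' iB' X (0\<^sub>m (oA' * oB') (iA' * iB')) = 0\<^sub>m (oA * oA' * (oB * oB')) (iA * iA' * (iB * iB'))"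
  by (rule eq_matI) (auto simp: index_btensor inner_index_less)

lemma mtrace_bstate:
  assumes "X \<in> carrier_mat (A * B) (A * B)" "Y \<in> carrier_mat (a' * b') (a' * b')"
  shows "mtrace (bstate A B a' b' X Y) = mtrace X * mtrace Y"
proof -
  have "mtrace (bstate A B a' b' X Y) = (\<Sum>k<A * a' * (B * b').
     (\<lambda>u v. X $$ (u, u) * Y $$ (v, v)) (outer_index B a' b' k) (inner_index B a' b' k))"
    unfolding mtrace_def by (auto intro!: sum.cong simp: index_btensor)
  also have "\<dots> = (\<Sum>u<A * B. \<Sum>v<a' * b'. X $$ (u, u) * Y $$ (v, v))"
    by (rule sum_composite_index)
  also have "\<dots> = mtrace X * mtrace Y"
    using assms by (simp add: mtrace_def sum_product)
  finally show ?thesis .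
qed

declare One_nat_def [simp del]

section \<open>Positive semidefinite and separable operators\<close>

lemma quadratic_form_sum:
  assumes "A \<in> carrier_mat n n" "dim_vec v = n"
  shows "conjugate v \<bullet> (A *\<^sub>v v) = (\<Sum>i<n. \<Sum>j<n. cnj (v $ i) * A $$ (i, j) * v $ j)"
  using assms by (simp add: scalar_prod_def lessThan_atLeast0 sum_distrib_left mult.assoc)

lemma scalar_prod_adjoint:
  fixes K :: "complex mat"
  assumes "K \<in> carrier_mat m n" "dim_vec v = m" "dim_vec w = n"
  shows "conjugate v \<bullet> (K *\<^sub>v w) = conjugate (adj K *\<^sub>v v) \<bullet> w"
proof -
  have "conjugate v \<bullet> (K *\<^sub>v w) = (\<Sum>i<m. \<Sum>j<n. cnj (v $ i) * K $$ (i, j) * w $ j)"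
    using assms by (simp add: scalar_prod_def lessThan_atLeast0 sum_distrib_left mult.assoc)
  also have "\<dots> = (\<Sum>j<n. \<Sum>i<m. K $$ (i, j) * cnj (v $ i) * w $ j)"
    by (subst sum.swap) (simp add: mult_ac)
  also have "\<dots> = conjugate (adj K *\<^sub>v v) \<bullet> w"
    using assms by (simp add: scalar_prod_def lessThan_atLeast0 sum_distrib_right)
  finally show ?thesis .
qed

lemma psd_carrier: "psd n A \<Longrightarrow> A \<in> carrier_mat n n"
  by (simp add: psd_def)

lemma psdI:
  assumes "A \<in> carrier_mat n n" "adj A = A"
    "\<And>v. dim_vec v = n \<Longrightarrow> Im (conjugate v \<bullet> (A *\<^sub>v v)) = 0 \<and> 0 \<le> Re (conjugate v \<bullet> (A *\<^sub>v v))"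
  shows "psd n A"
  unfolding psd_def using assms(1,3) assms(2)[symmetric] by blast

lemma psd_adjoint: "psd n A \<Longrightarrow> adj A = A"
  unfolding psd_def by (elim conjE) (erule sym)

lemma psd_form:
  assumes "psd n A" "dim_vec v = n"
  shows "Im (conjugate v \<bullet> (A *\<^sub>v v)) = 0" "0 \<le> Re (conjugate v \<bullet> (A *\<^sub>v v))"
  using assms by (simp_all only: psd_def)

lemma psd_zero: "psd n (0\<^sub>m n n)"
proof -
  have "conjugate v \<bullet> (0\<^sub>m n n *\<^sub>v v) = 0" if "dim_vec v = n" for v :: "complex vec"
    using that by (simp add: quadratic_form_sum[where n=n])
  moreover have "adj (0\<^sub>m n n) = 0\<^sub>m n n" by (rule eq_matI) auto
  ultimately show ?thesis by (intro psdI) auto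
qed

lemma psd_add:
  assumes "psd n A" "psd n B"
  shows "psd n (A + B)"
proof -
  have c: "A \<in> carrier_mat n n" "B \<in> carrier_mat n n" using assms by (auto simp: psd_def)
  have "conjugate v \<bullet> ((A + B) *\<^sub>v v) = conjugate v \<bullet> (A *\<^sub>v v) + conjugate v \<bullet> (B *\<^sub>v v)"
    if "dim_vec v = n" for v
    using c that by (simp add: quadratic_form_sum[where n=n] distrib_left distrib_right sum.distrib)
  moreover have "adj (A + B) = A + B"
    using assms adjoint_add[OF c] by (simp add: psd_def)
  ultimately show ?thesis using psd_form[OF assms(1)] psd_form[OF assms(2)] c by (intro psdI) simp_all
qed

lemma psd_conj:
  assumes "psd n A" "K \<in> carrier_mat m n"
  shows "psd m (K * A * adj K)"
proof -
  have A: "A \<in> carrier_mat n n" "adj A = A"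
    by (rule psd_carrier[OF assms(1)], rule psd_adjoint[OF assms(1)])
  have "conjugate v \<bullet> ((K * A * adj K) *\<^sub>v v) = conjugate (adj K *\<^sub>v v) \<bullet> (A *\<^sub>v (adj K *\<^sub>v v))"
    if "dim_vec v = m" for v
  proof -
    have v: "v \<in> carrier_vec m" using that by (rule carrier_vecI)
    have "(K * A * adj K) *\<^sub>v v = (K * A) *\<^sub>v (adj K *\<^sub>v v)"
      using A assms(2) v by (intro assoc_mult_mat_vec[where n\<^sub>3=m and n\<^sub>2=n and n\<^sub>1=m]) auto
    also have "\<dots> = K *\<^sub>v (A *\<^sub>v (adj K *\<^sub>v v))"
      using A assms(2) mult_mat_vec_carrier[OF adjoint_carrier[OF assms(2)] v] by (intro assoc_mult_mat_vec[where n\<^sub>3=n and n\<^sub>2=n and n\<^sub>1=m]) auto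
    finally show ?thesis
      using A assms(2) that by (simp add: scalar_prod_adjoint[where m=m and n=n])
  qed
  moreover have "adj (K * A * adj K) = K * A * adj K"
    using A assms(2) by (simp add: adjoint_mult assoc_mult_mat[where n\<^sub>1=m and n\<^sub>2=n and n\<^sub>3=n and n\<^sub>4=m])
  moreover have "K * A * adj K \<in> carrier_mat m m" using A assms(2) by auto
  moreover have "dim_vec (adj K *\<^sub>v v) = n" for v using assms(2) by simp
  ultimately show ?thesis using psd_form[OF assms(1)] by (intro psdI) simp_all
qed

lemma psd_one: "psd n (1\<^sub>m n)"
proof -
  have "conjugate v \<bullet> (1\<^sub>m n *\<^sub>v v) = of_real (\<Sum>i<n. (cmod (v $ i))\<^sup>2)" if "dim_vec v = n" for v
  proof -
    have "1\<^sub>m n *\<^sub>v v = v" using carrier_vecI[OF that] by simp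
    then show ?thesis
      using that by (simp add: scalar_prod_def lessThan_atLeast0 complex_norm_square mult.commute
          del: of_real_power)
  qed
  then show ?thesis by (intro psdI) (auto intro!: sum_nonneg)
qed

lemma psd_outer: "V \<in> carrier_mat n m \<Longrightarrow> psd n (V * adj V)"
  using psd_conj[OF psd_one, of V n m] by simp

lemma psd_diag:
  assumes "psd n A" "i < n"
  shows "Im (A $$ (i, i)) = 0" "0 \<le> Re (A $$ (i, i))"
proof -
  have A: "A \<in> carrier_mat n n" using assms by (simp add: psd_def)
  have "conjugate (unit_vec n i :: complex vec) \<bullet> (A *\<^sub>v unit_vec n i) =
      (\<Sum>k<n. \<Sum>l<n. if l = i then (if k = i then A $$ (k, l) else 0) else 0)"
    using A assms(2) by (subst quadratic_form_sum[where n=n], simp, simp, intro sum.cong[OF refl])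
      (auto simp: unit_vec_def)
  also have "\<dots> = A $$ (i, i)" using assms(2) by simp
  finally have *: "conjugate (unit_vec n i :: complex vec) \<bullet> (A *\<^sub>v unit_vec n i) = A $$ (i, i)" .
  show "Im (A $$ (i, i)) = 0" "0 \<le> Re (A $$ (i, i))"
    using assms(1) unfolding psd_def *[symmetric] by auto
qed

lemma psd_mtrace:
  assumes "psd n A"
  shows "Im (mtrace A) = 0" "0 \<le> Re (mtrace A)" "mtrace A = of_real (Re (mtrace A))"
proof -
  have A: "A \<in> carrier_mat n n" using assms by (simp add: psd_def)
  show "Im (mtrace A) = 0" "0 \<le> Re (mtrace A)"
    using A psd_diag[OF assms] by (auto simp: mtrace_def intro!: sum_nonneg)
  then show "mtrace A = of_real (Re (mtrace A))" by (simp add: complex_eq_iff)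
qed

lemma double_sum_nonneg:
  fixes f :: "'a \<Rightarrow> 'b \<Rightarrow> complex"
  assumes "\<And>i j. Im (f i j) = 0" "\<And>i j. 0 \<le> Re (f i j)"
  shows "Im (\<Sum>i\<in>I. \<Sum>j\<in>J. f i j) = 0" "0 \<le> Re (\<Sum>i\<in>I. \<Sum>j\<in>J. f i j)"
  by (simp_all add: assms sum_nonneg)

text \<open>The form of \<open>1 - A\<close> at \<open>v\<close> is half the sum over all \<open>i, j\<close> of the form of \<open>A\<close> at
  \<open>cnj v\<^sub>j e\<^sub>i - cnj v\<^sub>i e\<^sub>j\<close>.\<close>

lemma psd_one_minus:
  assumes "psd n A" "mtrace A = 1"
  shows "psd n (1\<^sub>m n - A)"
proof -
  have A: "A \<in> carrier_mat n n" "adj A = A"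
    by (rule psd_carrier[OF assms(1)], rule psd_adjoint[OF assms(1)])
  have form: "Im (conjugate v \<bullet> ((1\<^sub>m n - A) *\<^sub>v v)) = 0 \<and> 0 \<le> Re (conjugate v \<bullet> ((1\<^sub>m n - A) *\<^sub>v v))"
    if v: "dim_vec v = n" for v
  proof -
    define w where "w i j = vec n (\<lambda>k. (if k = i then cnj (v $ j) else 0) - (if k = j then cnj (v $ i) else 0))"
      for i j
    define q where "q u = conjugate u \<bullet> (A *\<^sub>v u)" for u
    define S where "S = (\<Sum>i<n. cnj (v $ i) * v $ i)"
    have qw: "q (w i j) = (cnj (v $ j) * v $ j) * A $$ (i, i) + (cnj (v $ i) * v $ i) * A $$ (j, j)
        - cnj (v $ i) * A $$ (i, j) * v $ j - cnj (v $ j) * A $$ (j, i) * v $ i"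
      if "i < n" "j < n" for i j
    proof -
      have inner: "(\<Sum>l<n. A $$ (k, l) * w i j $ l) = A $$ (k, i) * cnj (v $ j) - A $$ (k, j) * cnj (v $ i)" for k
      proof -
        have "(\<Sum>l<n. A $$ (k, l) * w i j $ l) =
          (\<Sum>l<n. (if l = i then A $$ (k, l) * cnj (v $ j) else 0) - (if l = j then A $$ (k, l) * cnj (v $ i) else 0))"
          by (intro sum.cong) (auto simp: w_def algebra_simps)
        then show ?thesis using that by (simp add: sum_subtractf)
      qed
      have "q (w i j) = (\<Sum>k<n. cnj (w i j $ k) * (\<Sum>l<n. A $$ (k, l) * w i j $ l))"
        unfolding q_def using A by (subst quadratic_form_sum) (auto simp: w_def sum_distrib_left mult.assoc)
      also have "\<dots> = (\<Sum>k<n. (if k = i then v $ j * (A $$ (k, i) * cnj (v $ j) - A $$ (k, j) * cnj (v $ i)) else 0)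
          - (if k = j then v $ i * (A $$ (k, i) * cnj (v $ j) - A $$ (k, j) * cnj (v $ i)) else 0))"
        unfolding inner by (intro sum.cong) (auto simp: w_def algebra_simps)
      finally show ?thesis using that by (simp add: sum_subtractf algebra_simps)
    qed
    have qv: "q v = (\<Sum>i<n. \<Sum>j<n. cnj (v $ i) * A $$ (i, j) * v $ j)"
      unfolding q_def using A(1) v by (rule quadratic_form_sum)
    \<comment> \<open>The unit trace enters here: both diagonal double sums collapse to
      \<open>S\<close>, the squared norm of \<open>v\<close>.\<close>
    have S1: "(\<Sum>i<n. \<Sum>j<n. cnj (v $ j) * v $ j * A $$ (i, i)) = S"
      using assms(2) A by (simp add: S_def mtrace_def sum_distrib_left[symmetric] sum_distrib_right[symmetric])
    have S2: "(\<Sum>i<n. \<Sum>j<n. cnj (v $ i) * v $ i * A $$ (j, j)) = S"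
      using S1 by (subst sum.swap)
    have q2: "(\<Sum>i<n. \<Sum>j<n. cnj (v $ j) * A $$ (j, i) * v $ i) = q v"
      unfolding qv by (rule sum.swap)
    have "(\<Sum>i<n. \<Sum>j<n. q (w i j)) = 2 * (S - q v)"
      using S1 S2 q2 by (simp add: qw sum.distrib sum_subtractf qv[symmetric])
    moreover have qn: "Im (q (w i j)) = 0" "0 \<le> Re (q (w i j))" for i j
      unfolding q_def by (auto intro!: psd_form[OF assms(1)] simp: w_def)
    have "Im (\<Sum>i<n. \<Sum>j<n. q (w i j)) = 0" "0 \<le> Re (\<Sum>i<n. \<Sum>j<n. q (w i j))"
      using qn by (rule double_sum_nonneg)+
    moreover have "conjugate v \<bullet> ((1\<^sub>m n - A) *\<^sub>v v) = S - q v"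
    proof -
      have "conjugate v \<bullet> ((1\<^sub>m n - A) *\<^sub>v v) =
          (\<Sum>i<n. \<Sum>j<n. cnj (v $ i) * (1\<^sub>m n - A) $$ (i, j) * v $ j)"
        using A(1) v by (intro quadratic_form_sum) auto
      also have "\<dots> = (\<Sum>i<n. \<Sum>j<n. (if j = i then cnj (v $ i) * v $ j else 0) - cnj (v $ i) * A $$ (i, j) * v $ j)"
        using A(1) by (intro sum.cong refl) (auto simp: algebra_simps)
      finally show ?thesis by (simp add: sum_subtractf S_def qv)
    qed
    ultimately show ?thesis by simp
  qed
  have "1\<^sub>m n - A \<in> carrier_mat n n" using A by auto
  moreover have "adj (1\<^sub>m n - A) = 1\<^sub>m n - A"
    using A adjoint_minus[of "1\<^sub>m n" n n A] by simp
  ultimately show ?thesis using form by (rule psdI)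
qed

section \<open>Conjugation by Kraus operators and the cone of separable operators\<close>

lemma conj_add:
  fixes K :: "complex mat"
  assumes "K \<in> carrier_mat m n" "X \<in> carrier_mat n n" "Y \<in> carrier_mat n n"
  shows "K * (X + Y) * adj K = K * X * adj K + K * Y * adj K"
  using assms by (simp add: mult_add_distrib_mat[where nr=m and n=n and nc=n]
      add_mult_distrib_mat[where nr=m and n=n and nc=m])

lemma conj_zero:
  fixes K :: "complex mat"
  assumes "K \<in> carrier_mat m n"
  shows "K * 0\<^sub>m n n * adj K = 0\<^sub>m m m"
  using assms by simp

lemma conj_conj:
  fixes K :: "complex mat"
  assumes "K \<in> carrier_mat m n" "L \<in> carrier_mat n k" "X \<in> carrier_mat k k"
  shows "K * (L * X * adj L) * adj K = (K * L) * X * adj (K * L)"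
proof -
  have "K * (L * X * adj L) = K * L * X * adj L"
    using assms by (simp add: assoc_mult_mat[where n\<^sub>1=m and n\<^sub>2=n and n\<^sub>3=k and n\<^sub>4=k]
      assoc_mult_mat[where n\<^sub>1=n and n\<^sub>2=k and n\<^sub>3=k and n\<^sub>4=n]
      assoc_mult_mat[where n\<^sub>1=m and n\<^sub>2=n and n\<^sub>3=k and n\<^sub>4=n]
      assoc_mult_mat[where n\<^sub>1=m and n\<^sub>2=k and n\<^sub>3=k and n\<^sub>4=n, symmetric])
  then show ?thesis
    using assms by (simp add: adjoint_mult
      assoc_mult_mat[where n\<^sub>1=m and n\<^sub>2=k and n\<^sub>3=n and n\<^sub>4=m])
qed

lemma conj_outer:
  fixes K :: "complex mat"
  assumes "K \<in> carrier_mat m n" "G \<in> carrier_mat n k"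
  shows "K * (G * adj G) * adj K = (K * G) * adj (K * G)"
  using conj_conj[OF assms one_carrier_mat] assms by simp

text \<open>Unnormalised separable operators, as finite sums of rank-one products. Vectors are
  one-column matrices, so that \<open>kron\<close>, \<open>*\<close> and \<open>adj\<close> treat
  them like Kraus operators; as they need not be unit vectors, convex weights are absorbed into
  them.\<close>

inductive sep_cone :: "nat \<Rightarrow> nat \<Rightarrow> complex mat \<Rightarrow> bool" for a b where
  zero: "sep_cone a b (0\<^sub>m (a * b) (a * b))"
| add: "\<alpha> \<in> carrier_mat a 1 \<Longrightarrow> \<beta> \<in> carrier_mat b 1 \<Longrightarrow> sep_cone a b X \<Longrightarrow>
    sep_cone a b (kron \<alpha> \<beta> * adj (kron \<alpha> \<beta>) + X)"

lemma kron_col_carrier: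
  "\<alpha> \<in> carrier_mat a 1 \<Longrightarrow> \<beta> \<in> carrier_mat b 1 \<Longrightarrow> kron \<alpha> \<beta> \<in> carrier_mat (a * b) 1"
  using kron_carrier[of \<alpha> a 1 \<beta> b 1] by simp

lemma sep_cone_psd: "sep_cone a b X \<Longrightarrow> psd (a * b) X"
  by (induction rule: sep_cone.induct) (auto intro: psd_zero psd_add psd_outer[OF kron_col_carrier])

lemmas sep_cone_carrier = psd_carrier[OF sep_cone_psd]

lemma outer_carrier: "G \<in> carrier_mat n m \<Longrightarrow> G * adj G \<in> carrier_mat n n"
  by auto

lemma sep_cone_add: "sep_cone a b X \<Longrightarrow> sep_cone a b Y \<Longrightarrow> sep_cone a b (X + Y)"
proof (induction rule: sep_cone.induct)
  case zero
  then show ?case using sep_cone_carrier[of a b Y] by simp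
next
  case (add \<alpha> \<beta> X)
  then show ?case
    using sep_cone.add[of \<alpha> a \<beta> b "X + Y"] sep_cone_carrier[of a b Y] sep_cone_carrier[of a b X]
      outer_carrier[OF kron_col_carrier[OF add(1,2)]]
    by (simp add: assoc_add_mat[where nr="a * b" and nc="a * b"])
qed

lemma sep_cone_outer:
  assumes "\<alpha> \<in> carrier_mat a 1" "\<beta> \<in> carrier_mat b 1"
  shows "sep_cone a b (kron \<alpha> \<beta> * adj (kron \<alpha> \<beta>))"
  using sep_cone.add[OF assms sep_cone.zero] outer_carrier[OF kron_col_carrier[OF assms]] by simp

lemma sep_cone_msum: "(\<And>M. M \<in> set Ms \<Longrightarrow> sep_cone a b M) \<Longrightarrow> sep_cone a b (msum (a * b) (a * b) Ms)"
  by (induction Ms) (auto intro: sep_cone.zero sep_cone_add)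

text \<open>A product operator sends the product vector \<open>kron \<alpha> \<beta>\<close> to the
  product vector \<open>kron (P * \<alpha>) (Q * \<beta>)\<close>, hence generators to
  generators.\<close>

lemma sep_cone_conj:
  assumes "sep_cone a b X" "P \<in> carrier_mat c a" "Q \<in> carrier_mat d b"
  shows "sep_cone c d (kron P Q * X * adj (kron P Q))"
  using assms(1)
proof (induction rule: sep_cone.induct)
  case zero
  show ?case using sep_cone.zero[of c d] assms by (simp add: conj_zero[OF kron_carrier[OF assms(2,3)]])
next
  case (add \<alpha> \<beta> X)
  have K: "kron P Q \<in> carrier_mat (c * d) (a * b)" using assms by simp
  have G: "kron \<alpha> \<beta> \<in> carrier_mat (a * b) 1" using add by (simp add: kron_col_carrier)
  have "kron P Q * kron \<alpha> \<beta> = kron (P * \<alpha>) (Q * \<beta>)"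
    using add assms by (intro kron_mult) auto
  then have eq: "kron P Q * (kron \<alpha> \<beta> * adj (kron \<alpha> \<beta>)) * adj (kron P Q) =
      kron (P * \<alpha>) (Q * \<beta>) * adj (kron (P * \<alpha>) (Q * \<beta>))"
    unfolding conj_outer[OF K G] by (simp only:)
  show ?case
    unfolding conj_add[OF K outer_carrier[OF G] sep_cone_carrier[OF add(3)]] eq
    by (rule sep_cone.add[OF mult_carrier_mat[OF assms(2) add(1)] mult_carrier_mat[OF assms(3) add(2)] add(4)])
qed

lemma bstate_outer:
  assumes "\<alpha> \<in> carrier_mat A 1" "\<beta> \<in> carrier_mat B 1" "\<gamma> \<in> carrier_mat a 1" "\<delta> \<in> carrier_mat b 1"
  shows "bstate A B a b (kron \<alpha> \<beta> * adj (kron \<alpha> \<beta>)) (kron \<gamma> \<delta> * adj (kron \<gamma> \<delta>)) =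
    kron (kron \<alpha> \<gamma>) (kron \<beta> \<delta>) * adj (kron (kron \<alpha> \<gamma>) (kron \<beta> \<delta>))"
proof -
  have c: "kron \<alpha> \<beta> \<in> carrier_mat (A * B) (1 * 1)" "kron \<gamma> \<delta> \<in> carrier_mat (a * b) (1 * 1)"
    using assms by (auto intro!: kron_carrier simp del: mult_1)
  have "bstate A B a b (kron \<alpha> \<beta> * adj (kron \<alpha> \<beta>)) (kron \<gamma> \<delta> * adj (kron \<gamma> \<delta>)) =
     btensor A B 1 1 a b 1 1 (kron \<alpha> \<beta>) (kron \<gamma> \<delta>) * adj (btensor A B 1 1 a b 1 1 (kron \<alpha> \<beta>) (kron \<gamma> \<delta>))"
    unfolding adjoint_btensor[OF c] using c by (intro btensor_mult[symmetric]) (auto intro!: adjoint_carrier)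
  then show ?thesis by (simp only: btensor_kron[OF assms(1,2,3,4)])
qed

text \<open>The tensor product is additive in each argument, and by \<open>bstate_outer\<close> two
  generators combine to a generator across AA'|BB'; hence one induction nested in another.\<close>

lemma sep_cone_bstate:
  assumes "sep_cone A B \<rho>" "sep_cone a b \<sigma>"
  shows "sep_cone (A * a) (B * b) (bstate A B a b \<rho> \<sigma>)"
  using assms(1)
proof (induction rule: sep_cone.induct)
  case zero
  then show ?case using sep_cone.zero[of "A * a" "B * b"] by (simp add: btensor_zero_left)
next
  case (add \<alpha> \<beta> X)
  let ?G = "kron \<alpha> \<beta> * adj (kron \<alpha> \<beta>)"
  have G: "?G \<in> carrier_mat (A * B) (A * B)"
    by (rule outer_carrier[OF kron_col_carrier[OF add(1,2)]])
  have "sep_cone (A * a) (B * b) (bstate A B a b ?G \<sigma>)"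
    using assms(2)
  proof (induction rule: sep_cone.induct)
    case zero
    then show ?case using sep_cone.zero[of "A * a" "B * b"] by (simp add: btensor_zero_right)
  next
    case H: (add \<gamma> \<delta> Y)
    have "kron \<alpha> \<gamma> \<in> carrier_mat (A * a) 1" "kron \<beta> \<delta> \<in> carrier_mat (B * b) 1"
      using add(1,2) H(1,2) by (auto intro!: kron_col_carrier)
    from sep_cone.add[OF this H(4)]
    show ?case
      unfolding btensor_add_right[OF outer_carrier[OF kron_col_carrier[OF H(1,2)]] sep_cone_carrier[OF H(3)]]
        bstate_outer[OF add(1,2) H(1,2)] .
  qed
  from sep_cone_add[OF this add(4)]
  show ?case
    unfolding btensor_add_left[OF G sep_cone_carrier[OF add(3)]] .
qed

text \<open>For one generator of the cone, tensoring with \<open>\<sigma>\<close> is conjugation of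
  \<open>\<sigma>\<close> by \<open>V\<close>, the product vector tensored with the identity on the
  memory. Positivity then comes from \<open>psd_conj\<close>, even for entangled
  \<open>\<sigma>\<close>.\<close>

lemma psd_bstate:
  assumes "sep_cone A B \<rho>" "psd (a * b) \<sigma>"
  shows "psd (A * a * (B * b)) (bstate A B a b \<rho> \<sigma>)"
  using assms(1)
proof (induction rule: sep_cone.induct)
  case zero
  then show ?case by (simp add: btensor_zero_left psd_zero)
next
  case (add \<alpha> \<beta> X)
  have c: "kron \<alpha> \<beta> \<in> carrier_mat (A * B) (1 * 1)" "adj (kron \<alpha> \<beta>) \<in> carrier_mat (1 * 1) (A * B)"
    using add kron_carrier[of \<alpha> A 1 \<beta> B 1] by auto
  have s: "\<sigma> \<in> carrier_mat (a * b) (a * b)" using assms(2) by (rule psd_carrier)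
  define V where "V = btensor A B 1 1 a b a b (kron \<alpha> \<beta>) (1\<^sub>m (a * b))"
  have "bstate A B a b (kron \<alpha> \<beta> * adj (kron \<alpha> \<beta>)) \<sigma> =
      bstate A B a b (kron \<alpha> \<beta> * 1\<^sub>m 1 * adj (kron \<alpha> \<beta>)) (1\<^sub>m (a * b) * \<sigma> * 1\<^sub>m (a * b))"
    using right_mult_one_mat[OF c(1)] s by simp
  also have "\<dots> = btensor A B 1 1 a b a b (kron \<alpha> \<beta> * 1\<^sub>m 1) (1\<^sub>m (a * b) * \<sigma>) *
      btensor 1 1 A B a b a b (adj (kron \<alpha> \<beta>)) (1\<^sub>m (a * b))"
    using c s by (intro btensor_mult[symmetric]) auto
  also have "btensor A B 1 1 a b a b (kron \<alpha> \<beta> * 1\<^sub>m 1) (1\<^sub>m (a * b) * \<sigma>) = V * btensor 1 1 1 1 a b a b (1\<^sub>m 1) \<sigma>"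
    unfolding V_def using c s by (intro btensor_mult[symmetric]) auto
  also have "btensor 1 1 1 1 a b a b (1\<^sub>m 1) \<sigma> = \<sigma>" using s by (rule btensor_one_left)
  also have "btensor 1 1 A B a b a b (adj (kron \<alpha> \<beta>)) (1\<^sub>m (a * b)) = adj V"
    unfolding V_def using adjoint_btensor[OF c(1), of "1\<^sub>m (a * b)" a b a b] by simp
  finally have "bstate A B a b (kron \<alpha> \<beta> * adj (kron \<alpha> \<beta>)) \<sigma> = V * \<sigma> * adj V" .
  moreover have "V \<in> carrier_mat (A * a * (B * b)) (a * b)"
    unfolding V_def using btensor_carrier[of A B 1 1 a b a b] by simp
  ultimately have "psd (A * a * (B * b)) (bstate A B a b (kron \<alpha> \<beta> * adj (kron \<alpha> \<beta>)) \<sigma>)"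
    using psd_conj[OF assms(2)] by simp
  from psd_add[OF this add(4)] show ?case
    unfolding btensor_add_left[OF outer_carrier[OF kron_col_carrier[OF add(1,2)]] sep_cone_carrier[OF add(3)]] .
qed

text \<open>Serves both as a decomposition of the identity into projectors onto basis vectors and as
  the measurement by which a system is discarded.\<close>

lemma ket_resolution:
  "msum n n (map (\<lambda>i. mat n 1 (\<lambda>(k, _). if k = i then 1 else 0) *
     adj (mat n 1 (\<lambda>(k, _). if k = i then 1 else 0))) [0..<n]) = 1\<^sub>m n"
proof -
  let ?P = "\<lambda>i. mat n 1 (\<lambda>(k, _). if k = i then 1 else 0) * adj (mat n 1 (\<lambda>(k, _). if k = i then 1 else 0))"
  have P: "?P i = mat n n (\<lambda>(k, l). if k = i \<and> l = i then 1 else 0)" for i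
    by (rule eq_matI) (auto simp: index_mult_sum simp del: index_mult_mat(1))
  have "msum n n (map (\<lambda>i. mat n n (\<lambda>(k, l). if k = i \<and> l = i then 1 else 0)) xs) = mat n n (\<lambda>(k, l). if k = l \<and> k \<in> set xs then 1 else 0)"
    if "distinct xs" for xs
    using that by (induction xs) (auto intro!: eq_matI)
  from this[of "[0..<n]"] show ?thesis unfolding P by (auto intro!: eq_matI)
qed

lemma sep_cone_one: "sep_cone a b (1\<^sub>m (a * b))"
proof -
  define e where "e n i = (mat n 1 (\<lambda>(k, _). if k = i then 1 else 0) :: complex mat)" for n i :: nat
  have ec: "e n i \<in> carrier_mat n 1" for n i by (simp add: e_def)
  \<comment> \<open>The projector onto the basis vector \<open>e n i\<close>; resolving each local
    identity into these writes the joint identity as a sum of product projectors.\<close>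
  define p where "p n i = e n i * adj (e n i)" for n i
  have pc: "p n i \<in> carrier_mat n n" for n i unfolding p_def by (rule outer_carrier[OF ec])
  have res: "1\<^sub>m n = msum n n (map (p n) [0..<n])" for n
    unfolding p_def e_def by (rule ket_resolution[symmetric])
  have "1\<^sub>m (a * b) = kron (1\<^sub>m a) (1\<^sub>m b)" by simp
  also have "\<dots> = msum (a * b) (a * b) (map (\<lambda>i. kron (p a i) (1\<^sub>m b)) [0..<a])"
    unfolding res[of a] by (subst kron_msum_left) (use pc in \<open>auto simp: comp_def\<close>)
  also have "(\<lambda>i. kron (p a i) (1\<^sub>m b)) =
      (\<lambda>i. msum (a * b) (a * b) (map (\<lambda>j. kron (p a i) (p b j)) [0..<b]))"
    unfolding res[of b] by (rule ext, subst kron_msum_right) (use pc in \<open>auto simp: comp_def\<close>)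
  finally have eq: "1\<^sub>m (a * b) = msum (a * b) (a * b) (map (\<lambda>i. msum (a * b) (a * b)
      (map (\<lambda>j. kron (p a i) (p b j)) [0..<b])) [0..<a])" .
  show ?thesis
    unfolding eq
  proof (intro sep_cone_msum, clarsimp, intro sep_cone_msum, clarsimp)
    fix i j
    have "kron (p a i) (p b j) = kron (e a i) (e b j) * adj (kron (e a i) (e b j))"
      unfolding p_def adjoint_kron using ec by (subst kron_mult) auto
    then show "sep_cone a b (kron (p a i) (p b j))"
      using sep_cone_outer[OF ec ec] by simp
  qed
qed

lemma SEP_sep_cone:
  assumes "SEP A B \<rho>"
  shows "sep_cone A B \<rho>" "mtrace \<rho> = 1"
proof -
  obtain ps where ps: "\<forall>(p, \<psi>, \<phi>) \<in> set ps. 0 \<le> p \<and> dim_vec \<psi> = A \<and> dim_vec \<phi> = B \<and>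
         conjugate \<psi> \<bullet> \<psi> = 1 \<and> conjugate \<phi> \<bullet> \<phi> = 1"
     "(\<Sum>(p, \<psi>, \<phi>) \<leftarrow> ps. p) = 1"
     "\<rho> = msum (A * B) (A * B)
            (map (\<lambda>(p, \<psi>, \<phi>). complex_of_real p \<cdot>\<^sub>m kron (proj \<psi>) (proj \<phi>)) ps)"
    using assms unfolding SEP_def by blast
  define ket where "ket c \<psi> = mat (dim_vec \<psi>) 1 (\<lambda>(i, _). c * \<psi> $ i)" for c :: complex and \<psi>
  have ketc: "ket c \<psi> \<in> carrier_mat (dim_vec \<psi>) 1" for c \<psi> by (simp add: ket_def)
  have ket_outer: "ket c \<psi> * adj (ket c \<psi>) = (c * cnj c) \<cdot>\<^sub>m proj \<psi>" for c \<psi>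
    by (rule eq_matI) (auto simp: ket_def proj_def index_mult_sum simp del: index_mult_mat(1))
  have tr_proj: "mtrace (proj \<psi>) = conjugate \<psi> \<bullet> \<psi>" for \<psi>
    by (simp add: mtrace_def proj_def scalar_prod_def lessThan_atLeast0 mult.commute)
  have *: "sep_cone A B (complex_of_real p \<cdot>\<^sub>m kron (proj \<psi>) (proj \<phi>)) \<and>
       mtrace (complex_of_real p \<cdot>\<^sub>m kron (proj \<psi>) (proj \<phi>)) = p"
    if "(p, \<psi>, \<phi>) \<in> set ps" for p \<psi> \<phi>
  proof -
    have d: "0 \<le> p" "dim_vec \<psi> = A" "dim_vec \<phi> = B" "conjugate \<psi> \<bullet> \<psi> = 1" "conjugate \<phi> \<bullet> \<phi> = 1"
      using ps(1) that by auto
    have c: "proj \<psi> \<in> carrier_mat A A" "proj \<phi> \<in> carrier_mat B B" using d by (auto simp: proj_def)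
    \<comment> \<open>The weight \<open>p\<close> is absorbed into the first ket as the amplitude
      \<open>sqrt p\<close>.\<close>
    have "complex_of_real p = complex_of_real (sqrt p) * cnj (complex_of_real (sqrt p))"
      using d(1) by (simp flip: of_real_mult)
    then have "complex_of_real p \<cdot>\<^sub>m kron (proj \<psi>) (proj \<phi>) =
        kron (ket (complex_of_real (sqrt p)) \<psi> * adj (ket (complex_of_real (sqrt p)) \<psi>)) (ket 1 \<phi> * adj (ket 1 \<phi>))"
      by (simp only: ket_outer kron_smult) simp
    also have "\<dots> = kron (ket (complex_of_real (sqrt p)) \<psi>) (ket 1 \<phi>) * adj (kron (ket (complex_of_real (sqrt p)) \<psi>) (ket 1 \<phi>))"
      unfolding adjoint_kron by (subst kron_mult) (auto simp: ket_def)
    finally have "sep_cone A B (complex_of_real p \<cdot>\<^sub>m kron (proj \<psi>) (proj \<phi>))"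
      using sep_cone_outer[of "ket (complex_of_real (sqrt p)) \<psi>" A "ket 1 \<phi>" B] ketc[of _ \<psi>] ketc[of _ \<phi>] d by simp
    moreover have "mtrace (complex_of_real p \<cdot>\<^sub>m kron (proj \<psi>) (proj \<phi>)) = p"
    proof -
      have "mtrace (kron (proj \<psi>) (proj \<phi>)) = mtrace (proj \<psi>) * mtrace (proj \<phi>)"
        using c by (simp add: mtrace_def sum_lessThan_mult index_kron mult_add_lessThan sum_product)
      then show ?thesis using c d by (simp add: mtrace_smult[OF kron_carrier] tr_proj)
    qed
    ultimately show ?thesis by simp
  qed
  show "sep_cone A B \<rho>"
    unfolding ps(3) using * by (intro sep_cone_msum) auto
  have "mtrace \<rho> = (\<Sum>(p, \<psi>, \<phi>) \<leftarrow> ps. complex_of_real p)"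
    unfolding ps(3) using *
    by (subst mtrace_msum) (auto intro!: sep_cone_carrier arg_cong[where f=sum_list] simp: comp_def split: prod.splits)
  also have "\<dots> = complex_of_real (\<Sum>(p, \<psi>, \<phi>) \<leftarrow> ps. p)"
    by (induction ps) auto
  finally show "mtrace \<rho> = 1" using ps(2) by simp
qed

section \<open>LOCC instruments\<close>

text \<open>Each round multiplies from the right by an operator of one party tensored with the
  identity of the other, and \<open>kron_mult\<close> keeps the product form. This form is why LOCC
  cannot create entanglement: with \<open>sep_cone_conj\<close> it preserves the separable
  cone.\<close>

lemma LOCC_kraus:
  assumes "LOCC a b c d L" "(x, K) \<in> set L"
  obtains P Q where "P \<in> carrier_mat c a" "Q \<in> carrier_mat d b" "K = kron P Q"
proof -
  have "\<exists>P Q. P \<in> carrier_mat c a \<and> Q \<in> carrier_mat d b \<and> K = kron P Q"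
    using assms
  proof (induction arbitrary: x K rule: LOCC.induct)
    case (finish a b y)
    then show ?case by (intro exI[of _ "1\<^sub>m a"] exI[of _ "1\<^sub>m b"]) simp
  next
    case (alice Es a2 a1 b a3 b3 C)
    then obtain i E K' where K': "(i, E) \<in> set Es" "(x, K') \<in> set (C i)" "K = K' * kron E (1\<^sub>m b)"
      by auto
    then have E: "E \<in> carrier_mat a2 a1" using alice(1) by auto
    have "\<exists>P Q. P \<in> carrier_mat a3 a2 \<and> Q \<in> carrier_mat b3 b \<and> K' = kron P Q"
      using alice(3) K' by force
    then obtain P Q where "P \<in> carrier_mat a3 a2" "Q \<in> carrier_mat b3 b" "K' = kron P Q" by blast
    then have "P * E \<in> carrier_mat a3 a1" "Q \<in> carrier_mat b3 b" "K = kron (P * E) Q"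
      using E unfolding K'(3) by (auto simp: kron_mult)
    then show ?case by blast
  next
    case (bob Fs b2 b1 a a3 b3 C)
    then obtain i F K' where K': "(i, F) \<in> set Fs" "(x, K') \<in> set (C i)" "K = K' * kron (1\<^sub>m a) F"
      by auto
    then have F: "F \<in> carrier_mat b2 b1" using bob(1) by auto
    have "\<exists>P Q. P \<in> carrier_mat a3 a \<and> Q \<in> carrier_mat b3 b2 \<and> K' = kron P Q"
      using bob(3) K' by force
    then obtain P Q where "P \<in> carrier_mat a3 a" "Q \<in> carrier_mat b3 b2" "K' = kron P Q" by blast
    then have "P \<in> carrier_mat a3 a" "Q * F \<in> carrier_mat b3 b1" "K = kron P (Q * F)"
      using F unfolding K'(3) by (auto simp: kron_mult)
    then show ?case by blast
  qed
  then show ?thesis using that by blast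
qed

lemma LOCC_carrier: "LOCC a b c d L \<Longrightarrow> (x, K) \<in> set L \<Longrightarrow> K \<in> carrier_mat (c * d) (a * b)"
  by (metis LOCC_kraus kron_carrier)

lemma sep_cone_LOCC:
  assumes "LOCC a b c d L" "(x, K) \<in> set L" "sep_cone a b X"
  shows "sep_cone c d (K * X * adj K)"
proof -
  obtain P Q where "P \<in> carrier_mat c a" "Q \<in> carrier_mat d b" "K = kron P Q"
    using LOCC_kraus[OF assms(1,2)] .
  then show ?thesis using sep_cone_conj[OF assms(3)] by simp
qed

lemma mtrace_conj:
  assumes "K \<in> carrier_mat m n" "X \<in> carrier_mat n n"
  shows "mtrace (K * X * adj K) = mtrace (adj K * K * X)"
proof -
  have "mtrace (K * X * adj K) = mtrace (adj K * (K * X))"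
    using assms by (intro mtrace_comm[where m=n and n=m]) auto
  then show ?thesis using assms by (simp add: assoc_mult_mat[where n\<^sub>1=n and n\<^sub>2=m and n\<^sub>3=n and n\<^sub>4=n])
qed

lemma kraus_trace_preserving:
  assumes "\<forall>(i, E) \<in> set Es. E \<in> carrier_mat m n"
    and "msum n n (map (\<lambda>(i, E). adj E * E) Es) = 1\<^sub>m n"
    and "X \<in> carrier_mat n n"
  shows "(\<Sum>(i, E)\<leftarrow>Es. mtrace (E * X * adj E)) = mtrace X"
proof -
  have c: "M \<in> carrier_mat n n" if "M \<in> set (map (\<lambda>(i, E). adj E * E) Es)" for M
    using that assms(1) by (auto intro!: mult_carrier_mat[where n=m] adjoint_carrier)
  have c': "M \<in> carrier_mat n n" if "M \<in> set (map (\<lambda>M. M * X) (map (\<lambda>(i, E). adj E * E) Es))" for M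
  proof -
    obtain N where "N \<in> set (map (\<lambda>(i, E). adj E * E) Es)" "M = N * X"
      using \<open>M \<in> _\<close> by auto
    then show ?thesis using mult_carrier_mat[OF c assms(3)] by blast
  qed
  have "mtrace X = mtrace (msum n n (map (\<lambda>(i, E). adj E * E) Es) * X)"
    unfolding assms(2) using assms(3) by simp
  also have "\<dots> = sum_list (map mtrace (map (\<lambda>M. M * X) (map (\<lambda>(i, E). adj E * E) Es)))"
    by (subst mult_msum_right[OF assms(3)], erule c, rule mtrace_msum, erule c')
  also have "\<dots> = (\<Sum>(i, E)\<leftarrow>Es. mtrace (E * X * adj E))"
    unfolding map_map using assms(1,3)
    by (intro arg_cong[where f=sum_list] map_cong refl)
      (auto simp: comp_def mtrace_conj[where m=m and n=n, symmetric])
  finally show ?thesis by simp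
qed

text \<open>The local completeness relation is tensored with an identity. That identity stands for
  the other party's system or for a party's own idle memory.\<close>

lemma kraus_kron_left:
  assumes "\<forall>(i, E) \<in> set Es. E \<in> carrier_mat m n"
    and "msum n n (map (\<lambda>(i, E). adj E * E) Es) = 1\<^sub>m n"
  shows "msum (n * b) (n * b) (map (\<lambda>(i, E). adj (kron E (1\<^sub>m b)) * kron E (1\<^sub>m b)) Es) = 1\<^sub>m (n * b)"
proof -
  have c: "M \<in> carrier_mat n n" if "M \<in> set (map (\<lambda>(i, E). adj E * E) Es)" for M
    using that assms(1) by (auto intro!: mult_carrier_mat[where n=m] adjoint_carrier)
  have "1\<^sub>m (n * b) = kron (1\<^sub>m n) (1\<^sub>m b)" by simp
  also have "\<dots> = msum (n * b) (n * b) (map (\<lambda>M. kron M (1\<^sub>m b)) (map (\<lambda>(i, E). adj E * E) Es))"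
    unfolding assms(2)[symmetric] by (rule kron_msum_left[OF c one_carrier_mat])
  also have "map (\<lambda>M. kron M (1\<^sub>m b)) (map (\<lambda>(i, E). adj E * E) Es) =
      map (\<lambda>(i, E). adj (kron E (1\<^sub>m b)) * kron E (1\<^sub>m b)) Es"
    using assms(1) by (auto simp: adjoint_kron kron_mult)
  finally show ?thesis by simp
qed

lemma kraus_kron_right:
  assumes "\<forall>(i, E) \<in> set Es. E \<in> carrier_mat m n"
    and "msum n n (map (\<lambda>(i, E). adj E * E) Es) = 1\<^sub>m n"
  shows "msum (a * n) (a * n) (map (\<lambda>(i, E). adj (kron (1\<^sub>m a) E) * kron (1\<^sub>m a) E) Es) = 1\<^sub>m (a * n)"
proof -
  have c: "M \<in> carrier_mat n n" if "M \<in> set (map (\<lambda>(i, E). adj E * E) Es)" for M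
    using that assms(1) by (auto intro!: mult_carrier_mat[where n=m] adjoint_carrier)
  have "1\<^sub>m (a * n) = kron (1\<^sub>m a) (1\<^sub>m n)" by simp
  also have "\<dots> = msum (a * n) (a * n) (map (\<lambda>M. kron (1\<^sub>m a) M) (map (\<lambda>(i, E). adj E * E) Es))"
    unfolding assms(2)[symmetric] by (rule kron_msum_right[OF c one_carrier_mat])
  also have "map (\<lambda>M. kron (1\<^sub>m a) M) (map (\<lambda>(i, E). adj E * E) Es) =
      map (\<lambda>(i, E). adj (kron (1\<^sub>m a) E) * kron (1\<^sub>m a) E) Es"
    using assms(1) by (auto simp: adjoint_kron kron_mult)
  finally show ?thesis by simp
qed

lemma sum_list_concat_map:
  "(\<Sum>y\<leftarrow>concat (map g xs). f y) = (\<Sum>x\<leftarrow>xs. \<Sum>y\<leftarrow>g x. f y)"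
  by (induction xs) auto

text \<open>Handles the rounds of both parties: \<open>G\<close> embeds a local operator into the
  joint space, as \<open>kron E (1\<^sub>m b)\<close> or \<open>kron (1\<^sub>m a) E\<close>. The
  continuation preserves the trace of each branch, and completeness of the embedded operators adds
  up the branches.\<close>

lemma trace_preserving_step:
  assumes "\<forall>(i, E) \<in> set Es. G E \<in> carrier_mat m n"
    and "msum n n (map (\<lambda>(i, E). adj (G E) * G E) Es) = 1\<^sub>m n"
    and "\<And>i E Y. (i, E) \<in> set Es \<Longrightarrow> Y \<in> carrier_mat m m \<Longrightarrow>
       (\<forall>(x, K) \<in> set (C i). K \<in> carrier_mat k m) \<and> (\<Sum>(x, K)\<leftarrow>C i. mtrace (K * Y * adj K)) = mtrace Y"
    and "X \<in> carrier_mat n n"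
  shows "(\<Sum>(x, K)\<leftarrow>concat (map (\<lambda>(i, E). map (\<lambda>(x, K). (x, K * G E)) (C i)) Es).
     mtrace (K * X * adj K)) = mtrace X"
proof -
  have "(\<Sum>(x, K)\<leftarrow>concat (map (\<lambda>(i, E). map (\<lambda>(x, K). (x, K * G E)) (C i)) Es). mtrace (K * X * adj K)) =
      (\<Sum>(i, E)\<leftarrow>Es. \<Sum>(x, K)\<leftarrow>C i. mtrace ((K * G E) * X * adj (K * G E)))"
    unfolding sum_list_concat_map by (simp add: case_prod_unfold comp_def)
  also have "\<dots> = (\<Sum>(i, E)\<leftarrow>Es. mtrace (G E * X * adj (G E)))"
  proof (intro arg_cong[where f=sum_list] map_cong refl, clarify)
    fix i E assume iE: "(i, E) \<in> set Es"
    then have E: "G E \<in> carrier_mat m n" using assms(1) by auto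
    then have Y: "G E * X * adj (G E) \<in> carrier_mat m m" using assms(4) by auto
    have "(\<Sum>(x, K)\<leftarrow>C i. mtrace ((K * G E) * X * adj (K * G E))) =
        (\<Sum>(x, K)\<leftarrow>C i. mtrace (K * (G E * X * adj (G E)) * adj K))"
      using assms(3)[OF iE Y] E assms(4)
      by (intro arg_cong[where f=sum_list] map_cong refl) (auto simp only: conj_conj split: prod.splits)
    also have "\<dots> = mtrace (G E * X * adj (G E))" using assms(3)[OF iE Y] by blast
    finally show "(\<Sum>(x, K)\<leftarrow>C i. mtrace ((K * G E) * X * adj (K * G E))) = mtrace (G E * X * adj (G E))" .
  qed
  also have "\<dots> = (\<Sum>(i, E)\<leftarrow>map (\<lambda>(i, E). (i, G E)) Es. mtrace (E * X * adj E))"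
    by (simp add: case_prod_unfold comp_def)
  also have "\<dots> = mtrace X"
    using assms(1,2,4) by (intro kraus_trace_preserving) (auto simp: case_prod_unfold comp_def)
  finally show ?thesis .
qed

lemma LOCC_trace_preserving:
  assumes "LOCC a b c d L" "X \<in> carrier_mat (a * b) (a * b)"
  shows "(\<Sum>(x, K)\<leftarrow>L. mtrace (K * X * adj K)) = mtrace X"
  using assms
proof (induction arbitrary: X rule: LOCC.induct)
  case (finish a b x)
  then show ?case by simp
next
  case (alice Es a2 a1 b a3 b3 C)
  have "(\<forall>(x, K)\<in>set (C i). K \<in> carrier_mat (a3 * b3) (a2 * b)) \<and> (\<Sum>(x, K)\<leftarrow>C i. mtrace (K * Y * adj K)) = mtrace Y"
    if "(i, E) \<in> set Es" "Y \<in> carrier_mat (a2 * b) (a2 * b)" for i E Y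
  proof -
    have "i \<in> fst ` set Es" using that(1) by force
    then have C: "LOCC a2 b a3 b3 (C i)" "(\<Sum>(x, K)\<leftarrow>C i. mtrace (K * Y * adj K)) = mtrace Y"
      using alice(3) that(2) by auto
    then show ?thesis using LOCC_carrier[OF C(1)] by auto
  qed
  then show ?case
    using alice(1,4) kraus_kron_left[OF alice(1,2)]
    by (intro trace_preserving_step[where G="\<lambda>E. kron E (1\<^sub>m b)" and k="a3 * b3" and m="a2 * b" and n="a1 * b"])
      (auto intro: kron_carrier)
next
  case (bob Fs b2 b1 a a3 b3 C)
  have "(\<forall>(x, K)\<in>set (C i). K \<in> carrier_mat (a3 * b3) (a * b2)) \<and> (\<Sum>(x, K)\<leftarrow>C i. mtrace (K * Y * adj K)) = mtrace Y"
    if "(i, E) \<in> set Fs" "Y \<in> carrier_mat (a * b2) (a * b2)" for i E Y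
  proof -
    have "i \<in> fst ` set Fs" using that(1) by force
    then have C: "LOCC a b2 a3 b3 (C i)" "(\<Sum>(x, K)\<leftarrow>C i. mtrace (K * Y * adj K)) = mtrace Y"
      using bob(3) that(2) by auto
    then show ?thesis using LOCC_carrier[OF C(1)] by auto
  qed
  then show ?case
    using bob(1,4) kraus_kron_right[OF bob(1,2)]
    by (intro trace_preserving_step[where G="\<lambda>E. kron (1\<^sub>m a) E" and k="a3 * b3" and m="a * b2" and n="a * b1"])
      (auto intro: kron_carrier)
qed

section \<open>Operations on LOCC instruments: relabelling, composition, preparation, discarding,
  idle systems\<close>

lemma LOCC_alice:
  fixes Es :: "(nat \<times> complex mat) list"
  assumes "\<forall>(i, E) \<in> set Es. E \<in> carrier_mat a2 a1"
    "msum a1 a1 (map (\<lambda>(i, E). adj E * E) Es) = 1\<^sub>m a1"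
    "\<forall>i \<in> fst ` set Es. LOCC a2 b c d (C i)"
    "L = concat (map (\<lambda>(i, E). map (\<lambda>(x, K). (x, K * kron E (1\<^sub>m b))) (C i)) Es)"
  shows "LOCC a1 b c d L"
  unfolding assms(4) by (rule LOCC.alice[OF assms(1-3)])

lemma LOCC_bob:
  fixes Fs :: "(nat \<times> complex mat) list"
  assumes "\<forall>(i, F) \<in> set Fs. F \<in> carrier_mat b2 b1"
    "msum b1 b1 (map (\<lambda>(i, F). adj F * F) Fs) = 1\<^sub>m b1"
    "\<forall>i \<in> fst ` set Fs. LOCC a b2 c d (C i)"
    "L = concat (map (\<lambda>(i, F). map (\<lambda>(x, K). (x, K * kron (1\<^sub>m a) F)) (C i)) Fs)"
  shows "LOCC a b1 c d L"
  unfolding assms(4) by (rule LOCC.bob[OF assms(1-3)])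

lemma LOCC_relabel:
  assumes "LOCC a b c d L"
  shows "LOCC a b c d (map (\<lambda>(x, K). (f x, K)) L)"
  using assms
proof (induction rule: LOCC.induct)
  case (finish a b x)
  then show ?case by (simp add: LOCC.finish)
next
  case (alice Es a2 a1 b a3 b3 C)
  show ?case
    by (rule LOCC_alice[OF alice(1,2), where C="\<lambda>i. map (\<lambda>(x, K). (f x, K)) (C i)"])
      (use alice(3) in \<open>auto simp: map_concat comp_def case_prod_unfold\<close>)
next
  case (bob Fs b2 b1 a a3 b3 C)
  show ?case
    by (rule LOCC_bob[OF bob(1,2), where C="\<lambda>i. map (\<lambda>(x, K). (f x, K)) (C i)"])
      (use bob(3) in \<open>auto simp: map_concat comp_def case_prod_unfold\<close>)
qed

text \<open>The second instrument may depend on the label of the first, but only its own label is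
  kept; a continuation that should retain \<open>x\<close> must emit \<open>x\<close>
  itself.\<close>

definition instr_comp :: "('a \<times> complex mat) list \<Rightarrow> ('a \<Rightarrow> ('b \<times> complex mat) list) \<Rightarrow> ('b \<times> complex mat) list" where
  "instr_comp L D = concat (map (\<lambda>(x, K). map (\<lambda>(y, K'). (y, K' * K)) (D x)) L)"

lemma instr_comp_step:
  assumes "\<And>i E x K y K'. (i, E) \<in> set Es \<Longrightarrow> (x, K) \<in> set (C i) \<Longrightarrow> (y, K') \<in> set (D x) \<Longrightarrow>
    K' * (K * G E) = K' * K * G E"
  shows "instr_comp (concat (map (\<lambda>(i, E). map (\<lambda>(x, K). (x, K * G E)) (C i)) Es)) D =
    concat (map (\<lambda>(i, E). map (\<lambda>(y, K'). (y, K' * G E)) (instr_comp (C i) D)) Es)"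
proof -
  have "instr_comp (concat (map (\<lambda>(i, E). map (\<lambda>(x, K). (x, K * G E)) (C i)) Es)) D =
     concat (map (\<lambda>(i, E). concat (map (\<lambda>(x, K). map (\<lambda>(y, K'). (y, K' * (K * G E))) (D x)) (C i))) Es)"
    unfolding instr_comp_def by (induction Es) (auto simp: comp_def case_prod_unfold)
  also have "\<dots> = concat (map (\<lambda>(i, E). concat (map (\<lambda>(x, K). map (\<lambda>(y, K'). (y, K' * K * G E)) (D x)) (C i))) Es)"
    using assms by (intro arg_cong[where f=concat] map_cong refl) (auto intro!: arg_cong[where f=concat])
  also have "\<dots> = concat (map (\<lambda>(i, E). map (\<lambda>(y, K'). (y, K' * G E)) (instr_comp (C i) D)) Es)"
    unfolding instr_comp_def by (auto simp: map_concat comp_def case_prod_unfold)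
  finally show ?thesis .
qed

text \<open>The continuation \<open>D x\<close> is grafted onto the leaves of the protocol tree. The
  earlier rounds keep their shape, so it remains to reassociate products of Kraus operators.\<close>

lemma LOCC_comp:
  assumes "LOCC a b c d L" "\<And>x. LOCC c d e f (D x)"
  shows "LOCC a b e f (instr_comp L D)"
  using assms
proof (induction rule: LOCC.induct)
  case (finish a b x)
  have "map (\<lambda>(y, K'). (y, K' * 1\<^sub>m (a * b))) (D x) = D x"
    using right_mult_one_mat[OF LOCC_carrier[OF finish[of x]]] by (intro map_idI) auto
  then show ?case using finish by (simp add: instr_comp_def)
next
  case (alice Es a2 a1 b a3 b3 C)
  show ?case
  proof (rule LOCC_alice[OF alice(1,2), where C="\<lambda>i. instr_comp (C i) D"])
    show "\<forall>i\<in>fst ` set Es. LOCC a2 b e f (instr_comp (C i) D)" using alice by blast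
    show "instr_comp (concat (map (\<lambda>(i, E). map (\<lambda>(x, K). (x, K * kron E (1\<^sub>m b))) (C i)) Es)) D =
      concat (map (\<lambda>(i, E). map (\<lambda>(x, K). (x, K * kron E (1\<^sub>m b))) (instr_comp (C i) D)) Es)"
    proof (rule instr_comp_step[where G="\<lambda>E. kron E (1\<^sub>m b)"])
      fix i E x K y K'
      assume iE: "(i, E) \<in> set Es" and K: "(x, K) \<in> set (C i)" and K': "(y, K') \<in> set (D x)"
      have "kron E (1\<^sub>m b) \<in> carrier_mat (a2 * b) (a1 * b)" using iE alice(1) by auto
      moreover have "K \<in> carrier_mat (a3 * b3) (a2 * b)" using alice(3) imageI[OF iE, of fst] LOCC_carrier[OF _ K] by auto
      moreover have "K' \<in> carrier_mat (e * f) (a3 * b3)" using LOCC_carrier[OF alice(4) K'] .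
      ultimately show "K' * (K * kron E (1\<^sub>m b)) = K' * K * kron E (1\<^sub>m b)"
        by (intro assoc_mult_mat[symmetric])
    qed
  qed
next
  case (bob Fs b2 b1 a a3 b3 C)
  show ?case
  proof (rule LOCC_bob[OF bob(1,2), where C="\<lambda>i. instr_comp (C i) D"])
    show "\<forall>i\<in>fst ` set Fs. LOCC a b2 e f (instr_comp (C i) D)" using bob by blast
    show "instr_comp (concat (map (\<lambda>(i, E). map (\<lambda>(x, K). (x, K * kron (1\<^sub>m a) E)) (C i)) Fs)) D =
      concat (map (\<lambda>(i, E). map (\<lambda>(x, K). (x, K * kron (1\<^sub>m a) E)) (instr_comp (C i) D)) Fs)"
    proof (rule instr_comp_step[where G="\<lambda>E. kron (1\<^sub>m a) E"])
      fix i E x K y K'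
      assume iE: "(i, E) \<in> set Fs" and K: "(x, K) \<in> set (C i)" and K': "(y, K') \<in> set (D x)"
      have "kron (1\<^sub>m a) E \<in> carrier_mat (a * b2) (a * b1)" using iE bob(1) by auto
      moreover have "K \<in> carrier_mat (a3 * b3) (a * b2)" using bob(3) imageI[OF iE, of fst] LOCC_carrier[OF _ K] by auto
      moreover have "K' \<in> carrier_mat (e * f) (a3 * b3)" using LOCC_carrier[OF bob(4) K'] .
      ultimately show "K' * (K * kron (1\<^sub>m a) E) = K' * K * kron (1\<^sub>m a) E"
        by (intro assoc_mult_mat[symmetric])
    qed
  qed
qed

text \<open>An isometry is an instrument with a single outcome, so each party performs its own in
  one additional round. This models the local preparation of a product memory.\<close>

lemma LOCC_prepend:
  assumes "E \<in> carrier_mat a2 a1" "adj E * E = 1\<^sub>m a1" "F \<in> carrier_mat b2 b1" "adj F * F = 1\<^sub>m b1"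
    and "LOCC a2 b2 c d L"
  shows "LOCC a1 b1 c d (map (\<lambda>(x, K). (x, K * kron E F)) L)"
proof -
  have "LOCC a2 b1 c d (map (\<lambda>(x, K). (x, K * kron (1\<^sub>m a2) F)) L)"
    using assms by (intro LOCC_bob[where Fs="[(0, F)]" and C="\<lambda>_. L"]) auto
  then have "LOCC a1 b1 c d (map (\<lambda>(x, K). (x, K * kron E (1\<^sub>m b1))) (map (\<lambda>(x, K). (x, K * kron (1\<^sub>m a2) F)) L))"
    using assms by (intro LOCC_alice[where Es="[(0, E)]" and C="\<lambda>_. map (\<lambda>(x, K). (x, K * kron (1\<^sub>m a2) F)) L"]) auto
  moreover have "map (\<lambda>(x, K). (x, K * kron E (1\<^sub>m b1))) (map (\<lambda>(x, K). (x, K * kron (1\<^sub>m a2) F)) L) =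
      map (\<lambda>(x, K). (x, K * kron E F)) L"
  proof -
    have "K * kron (1\<^sub>m a2) F * kron E (1\<^sub>m b1) = K * kron E F" if "(x, K) \<in> set L" for x K
    proof -
      have "K \<in> carrier_mat (c * d) (a2 * b2)" using LOCC_carrier[OF assms(5) that] .
      moreover have "kron (1\<^sub>m a2) F \<in> carrier_mat (a2 * b2) (a2 * b1)" "kron E (1\<^sub>m b1) \<in> carrier_mat (a2 * b1) (a1 * b1)"
        using assms by auto
      ultimately have "K * kron (1\<^sub>m a2) F * kron E (1\<^sub>m b1) = K * (kron (1\<^sub>m a2) F * kron E (1\<^sub>m b1))"
        by (rule assoc_mult_mat)
      also have "kron (1\<^sub>m a2) F * kron E (1\<^sub>m b1) = kron E F"
        using assms by (simp add: kron_mult)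
      finally show ?thesis .
    qed
    then show ?thesis by auto
  qed
  ultimately show ?thesis by (simp only:)
qed

text \<open>Both parties measure in the standard basis, with the bras \<open>adj (e n i)\<close> as
  Kraus operators of output dimension 1, and every leaf carries the label \<open>x\<close>. The
  system is traced out while a label obtained earlier can be handed on.\<close>

lemma LOCC_discard:
  obtains D where "LOCC a b 1 1 D" "\<And>y K. (y, K) \<in> set D \<Longrightarrow> y = x"
proof -
  define e where "e n i = (mat n 1 (\<lambda>(k, _). if k = i then 1 else 0) :: complex mat)" for n i :: nat
  have ec: "e n i \<in> carrier_mat n 1" for n i by (simp add: e_def)
  define Ms where "Ms n = map (\<lambda>i. (i, adj (e n i))) [0..<n]" for n
  have Ms: "\<forall>(i, E) \<in> set (Ms n). E \<in> carrier_mat 1 n" "msum n n (map (\<lambda>(i, E). adj E * E) (Ms n)) = 1\<^sub>m n" for n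
    using ec ket_resolution[of n] by (auto simp: Ms_def comp_def e_def[symmetric])
  define D1 where "D1 = concat (map (\<lambda>(i, F). map (\<lambda>(x, K). (x, K * kron (1\<^sub>m 1) F)) [(x, 1\<^sub>m (1 * 1))]) (Ms b))"
  define D where "D = concat (map (\<lambda>(i, F). map (\<lambda>(x, K). (x, K * kron F (1\<^sub>m b))) D1) (Ms a))"
  have "LOCC 1 b 1 1 D1"
    by (rule LOCC_bob[OF Ms, where C="\<lambda>_. [(x, 1\<^sub>m (1 * 1))]"]) (use LOCC.finish[of 1 1 x] D1_def in auto)
  then have "LOCC a b 1 1 D"
    by (intro LOCC_alice[OF Ms, where C="\<lambda>_. D1"]) (use D_def in auto)
  moreover have "y = x" if "(y, K) \<in> set D" for y K
    using that by (auto simp: D_def D1_def)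
  ultimately show ?thesis using that by blast
qed

text \<open>The protocol runs on AB while A'B' stays idle: every local Kraus operator is tensored
  with the identity on the memory of the acting party, and \<open>btensor_kron\<close> identifies
  this with the joint operator.\<close>

lemma LOCC_btensor:
  assumes "LOCC A B C D L"
  shows "LOCC (A * a) (B * b) (C * a) (D * b)
    (map (\<lambda>(x, K). (x, btensor C D A B a b a b K (1\<^sub>m (a * b)))) L)"
  using assms
proof (induction rule: LOCC.induct)
  case (finish A B x)
  have "btensor A B A B a b a b (1\<^sub>m (A * B)) (1\<^sub>m (a * b)) = 1\<^sub>m (A * a * (B * b))"
    unfolding kron_one[symmetric] by (rule btensor_kron) auto
  then show ?case using LOCC.finish[of "A * a" "B * b" x] by simp
next
  case (alice Es A2 A1 B A3 B3 C)
  let ?T = "\<lambda>A2 B A3 B3 K. btensor A3 B3 A2 B a b a b K (1\<^sub>m (a * b))"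
  let ?Es = "map (\<lambda>(i, E). (i, kron E (1\<^sub>m a))) Es"
  show ?case
  proof (rule LOCC_alice[where Es="?Es" and C="\<lambda>i. map (\<lambda>(x, K). (x, ?T A2 B A3 B3 K)) (C i)"])
    show "\<forall>(i, E)\<in>set ?Es. E \<in> carrier_mat (A2 * a) (A1 * a)" using alice(1) by auto
    show "msum (A1 * a) (A1 * a) (map (\<lambda>(i, E). adj E * E) ?Es) = 1\<^sub>m (A1 * a)"
      using kraus_kron_left[OF alice(1,2), of a] by (simp add: case_prod_unfold comp_def)
    show "\<forall>i\<in>fst ` set ?Es. LOCC (A2 * a) (B * b) (A3 * a) (B3 * b) (map (\<lambda>(x, K). (x, ?T A2 B A3 B3 K)) (C i))"
      using alice(3) by force
    have "?T A1 B A3 B3 (K * kron E (1\<^sub>m B)) = ?T A2 B A3 B3 K * kron (kron E (1\<^sub>m a)) (1\<^sub>m (B * b))"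
      if "(i, E) \<in> set Es" "(x, K) \<in> set (C i)" for i E x K
    proof -
      have E: "E \<in> carrier_mat A2 A1" using that alice(1) by auto
      have K: "K \<in> carrier_mat (A3 * B3) (A2 * B)" using alice(3) imageI[OF that(1), of fst] LOCC_carrier[OF _ that(2)] by auto
      have "kron (kron E (1\<^sub>m a)) (1\<^sub>m (B * b)) = btensor A2 B A1 B a b a b (kron E (1\<^sub>m B)) (1\<^sub>m (a * b))"
        unfolding kron_one[symmetric] using E by (intro btensor_kron[symmetric]) auto
      then have "?T A2 B A3 B3 K * kron (kron E (1\<^sub>m a)) (1\<^sub>m (B * b)) =
         btensor A3 B3 A1 B a b a b (K * kron E (1\<^sub>m B)) (1\<^sub>m (a * b) * 1\<^sub>m (a * b))"
        using E K by (simp only:) (intro btensor_mult, auto)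
      then show ?thesis by simp
    qed
    then show "map (\<lambda>(x, K). (x, ?T A1 B A3 B3 K))
       (concat (map (\<lambda>(i, E). map (\<lambda>(x, K). (x, K * kron E (1\<^sub>m B))) (C i)) Es)) =
      concat (map (\<lambda>(i, E). map (\<lambda>(x, K). (x, K * kron E (1\<^sub>m (B * b))))
        (map (\<lambda>(x, K). (x, ?T A2 B A3 B3 K)) (C i))) ?Es)"
      by (auto simp: map_concat comp_def case_prod_unfold intro!: arg_cong[where f=concat])
  qed
next
  case (bob Fs B2 B1 A A3 B3 C)
  let ?T = "\<lambda>A B2 A3 B3 K. btensor A3 B3 A B2 a b a b K (1\<^sub>m (a * b))"
  let ?Fs = "map (\<lambda>(i, F). (i, kron F (1\<^sub>m b))) Fs"
  show ?case
  proof (rule LOCC_bob[where Fs="?Fs" and C="\<lambda>i. map (\<lambda>(x, K). (x, ?T A B2 A3 B3 K)) (C i)"])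
    show "\<forall>(i, E)\<in>set ?Fs. E \<in> carrier_mat (B2 * b) (B1 * b)" using bob(1) by auto
    show "msum (B1 * b) (B1 * b) (map (\<lambda>(i, E). adj E * E) ?Fs) = 1\<^sub>m (B1 * b)"
      using kraus_kron_left[OF bob(1,2), of b] by (simp add: case_prod_unfold comp_def)
    show "\<forall>i\<in>fst ` set ?Fs. LOCC (A * a) (B2 * b) (A3 * a) (B3 * b) (map (\<lambda>(x, K). (x, ?T A B2 A3 B3 K)) (C i))"
      using bob(3) by force
    have "?T A B1 A3 B3 (K * kron (1\<^sub>m A) F) = ?T A B2 A3 B3 K * kron (1\<^sub>m (A * a)) (kron F (1\<^sub>m b))"
      if "(i, F) \<in> set Fs" "(x, K) \<in> set (C i)" for i F x K
    proof -
      have F: "F \<in> carrier_mat B2 B1" using that bob(1) by auto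
      have K: "K \<in> carrier_mat (A3 * B3) (A * B2)" using bob(3) imageI[OF that(1), of fst] LOCC_carrier[OF _ that(2)] by auto
      have "kron (1\<^sub>m (A * a)) (kron F (1\<^sub>m b)) = btensor A B2 A B1 a b a b (kron (1\<^sub>m A) F) (1\<^sub>m (a * b))"
        unfolding kron_one[symmetric] using F by (intro btensor_kron[symmetric]) auto
      then have "?T A B2 A3 B3 K * kron (1\<^sub>m (A * a)) (kron F (1\<^sub>m b)) =
         btensor A3 B3 A B1 a b a b (K * kron (1\<^sub>m A) F) (1\<^sub>m (a * b) * 1\<^sub>m (a * b))"
        using F K by (simp only:) (intro btensor_mult, auto)
      then show ?thesis by simp
    qed
    then show "map (\<lambda>(x, K). (x, ?T A B1 A3 B3 K))
       (concat (map (\<lambda>(i, F). map (\<lambda>(x, K). (x, K * kron (1\<^sub>m A) F)) (C i)) Fs)) =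
      concat (map (\<lambda>(i, F). map (\<lambda>(x, K). (x, K * kron (1\<^sub>m (A * a)) F))
        (map (\<lambda>(x, K). (x, ?T A B2 A3 B3 K)) (C i))) ?Fs)"
      by (auto simp: map_concat comp_def case_prod_unfold intro!: arg_cong[where f=concat])
  qed
qed

text \<open>A catalytic round is the channel followed by the measurement with the catalyst idle. The
  continuation is the same for every label, as the transcript of the channel is forgotten.\<close>

lemma cat_round_LOCC:
  assumes "LOCC (dA * a) (dB * b) (dA * a) (dB * b) Lam" "LOCC dA dB 1 1 M"
  shows "LOCC (dA * a) (dB * b) a b (cat_round dA dB a b Lam M)"
proof -
  let ?M = "map (\<lambda>(x, K). (x, btensor 1 1 dA dB a b a b K (1\<^sub>m (a * b)))) M"
  have "cat_round dA dB a b Lam M = instr_comp Lam (\<lambda>_. ?M)"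
    by (simp add: cat_round_def instr_comp_def comp_def case_prod_unfold)
  then show ?thesis
    using LOCC_comp[OF assms(1), where D="\<lambda>_. ?M"] LOCC_btensor[OF assms(2), of a b] by simp
qed

section \<open>Success probabilities\<close>

text \<open>The probability weight of the event \<open>Q\<close> for an unnormalised input; on
  positive semidefinite \<open>X\<close> the traces are real, so the real part loses
  nothing.\<close>

definition outcome_prob :: "('a \<times> complex mat) list \<Rightarrow> ('a \<Rightarrow> bool) \<Rightarrow> complex mat \<Rightarrow> real" where
  "outcome_prob L Q X = (\<Sum>(x, K)\<leftarrow>L. if Q x then Re (mtrace (K * X * adj K)) else 0)"

lemma LOCC_carriers: "LOCC a b c d L \<Longrightarrow> \<forall>(x, K) \<in> set L. K \<in> carrier_mat (c * d) (a * b)"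
  by (auto dest: LOCC_carrier)

lemma outcome_prob_total:
  assumes "LOCC a b c d L" "X \<in> carrier_mat (a * b) (a * b)"
  shows "outcome_prob L (\<lambda>_. True) X = Re (mtrace X)"
proof -
  have "outcome_prob L (\<lambda>_. True) X = Re (\<Sum>(x, K)\<leftarrow>L. mtrace (K * X * adj K))"
    unfolding outcome_prob_def by (induction L) auto
  then show ?thesis by (simp add: LOCC_trace_preserving[OF assms])
qed

lemma outcome_prob_compl:
  "outcome_prob L Q X + outcome_prob L (\<lambda>x. \<not> Q x) X = outcome_prob L (\<lambda>_. True) X"
  unfolding outcome_prob_def by (induction L) auto

text \<open>An instrument lists Kraus operators, and several may share a label, whereas the LOCC
  norm sums over distinct labels. Merging equal labels connects the two.\<close>

lemma outcome_prob_by_label: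
  assumes "finite S" "fst ` set L \<subseteq> S"
  shows "outcome_prob L Q X = (\<Sum>y\<in>S. if Q y then outcome_prob L (\<lambda>x. x = y) X else 0)"
  using assms(2)
proof (induction L)
  case Nil
  then show ?case by (simp add: outcome_prob_def)
next
  case (Cons p L)
  obtain x K where p: "p = (x, K)" by (cases p)
  let ?T = "Re (mtrace (K * X * adj K))"
  have x: "x \<in> S" using Cons.prems p by simp
  have "(\<Sum>y\<in>S. if Q y then outcome_prob (p # L) (\<lambda>x. x = y) X else 0) =
      (\<Sum>y\<in>S. (if x = y then (if Q y then ?T else 0) else 0) + (if Q y then outcome_prob L (\<lambda>x. x = y) X else 0))"
    by (intro sum.cong refl) (simp add: outcome_prob_def p)
  also have "\<dots> = (if Q x then ?T else 0) + outcome_prob L Q X"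
    using Cons x assms(1) by (simp add: sum.distrib)
  finally show ?case by (simp add: outcome_prob_def p)
qed

lemma outcome_prob_add:
  assumes "\<forall>(x, K) \<in> set L. K \<in> carrier_mat m n" "X \<in> carrier_mat n n" "Y \<in> carrier_mat n n"
  shows "outcome_prob L Q (X + Y) = outcome_prob L Q X + outcome_prob L Q Y"
  using assms(1)
proof (induction L)
  case Nil
  then show ?case by (simp add: outcome_prob_def)
next
  case (Cons p L)
  obtain x K where p: "p = (x, K)" by (cases p)
  have K: "K \<in> carrier_mat m n" using Cons.prems p by simp
  then have c: "K * Z * adj K \<in> carrier_mat m m" if "Z \<in> carrier_mat n n" for Z using that by auto
  have "mtrace (K * (X + Y) * adj K) = mtrace (K * X * adj K) + mtrace (K * Y * adj K)"
    unfolding conj_add[OF K assms(2,3)] by (rule mtrace_add[OF c c]) (use assms in auto)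
  moreover have "outcome_prob L Q (X + Y) = outcome_prob L Q X + outcome_prob L Q Y"
    using Cons by auto
  ultimately show ?case by (simp add: outcome_prob_def p)
qed

lemma outcome_prob_smult:
  assumes "\<forall>(x, K) \<in> set L. K \<in> carrier_mat m n" "X \<in> carrier_mat n n"
  shows "outcome_prob L Q (complex_of_real k \<cdot>\<^sub>m X) = k * outcome_prob L Q X"
  using assms(1)
proof (induction L)
  case Nil
  then show ?case by (simp add: outcome_prob_def)
next
  case (Cons p L)
  obtain x K where p: "p = (x, K)" by (cases p)
  have K: "K \<in> carrier_mat m n" using Cons.prems p by simp
  have "K * (complex_of_real k \<cdot>\<^sub>m X) * adj K = complex_of_real k \<cdot>\<^sub>m (K * X * adj K)"
    using K assms(2) by (simp add: mult_smult_distrib[where nr=m and n=n and nc=n]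
        mult_smult_assoc_mat[where nr=m and n=n and nc=m])
  moreover have "K * X * adj K \<in> carrier_mat m m" using K assms(2) by auto
  ultimately have "mtrace (K * (complex_of_real k \<cdot>\<^sub>m X) * adj K) = complex_of_real k * mtrace (K * X * adj K)"
    by (simp only: mtrace_smult)
  moreover have "outcome_prob L Q (complex_of_real k \<cdot>\<^sub>m X) = k * outcome_prob L Q X"
    using Cons by auto
  ultimately show ?case by (simp add: outcome_prob_def p distrib_left)
qed

lemma outcome_prob_zero:
  assumes "\<forall>(x, K) \<in> set L. K \<in> carrier_mat m n"
  shows "outcome_prob L Q (0\<^sub>m n n) = 0"
  using outcome_prob_smult[OF assms zero_carrier_mat, where k=0] by simp

lemma outcome_prob_nonneg:
  assumes "\<forall>(x, K) \<in> set L. K \<in> carrier_mat m n" "psd n X"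
  shows "0 \<le> outcome_prob L Q X"
  unfolding outcome_prob_def
  using assms(1) psd_mtrace(2)[OF psd_conj[OF assms(2)]]
  by (intro sum_list_nonneg) (auto split: prod.splits)

lemma outcome_prob_conj:
  assumes "\<forall>(x, K) \<in> set L. K \<in> carrier_mat m n" "W \<in> carrier_mat n k" "X \<in> carrier_mat k k"
  shows "outcome_prob (map (\<lambda>(x, K). (x, K * W)) L) Q X = outcome_prob L Q (W * X * adj W)"
  unfolding outcome_prob_def map_map
proof (intro arg_cong[where f=sum_list] map_cong refl, clarify)
  fix x K assume "(x, K) \<in> set L"
  then have K: "K \<in> carrier_mat m n" using assms(1) by auto
  show "((\<lambda>(x, K). if Q x then Re (mtrace (K * X * adj K)) else 0) \<circ> (\<lambda>(x, K). (x, K * W))) (x, K) =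
      (if Q x then Re (mtrace (K * (W * X * adj W) * adj K)) else 0)"
    using conj_conj[OF K assms(2,3)] by simp
qed

lemma outcome_prob_relabel:
  "outcome_prob (map (\<lambda>(x, K). (f x, K)) L) Q X = outcome_prob L (\<lambda>x. Q (f x)) X"
  unfolding outcome_prob_def by (simp add: comp_def case_prod_unfold cong: if_cong)

text \<open>Each \<open>D x\<close> preserves the trace and only emits \<open>x\<close>, so
  appending it leaves the distribution of the labels unchanged.\<close>

lemma outcome_prob_comp:
  assumes "LOCC a b c d L" "X \<in> carrier_mat (a * b) (a * b)"
    "\<And>x. LOCC c d e f (D x)" "\<And>x y K. (y, K) \<in> set (D x) \<Longrightarrow> y = x"
  shows "outcome_prob (instr_comp L D) Q X = outcome_prob L Q X"
proof -
  have "outcome_prob (instr_comp L D) Q X = (\<Sum>(x, K)\<leftarrow>L. \<Sum>(y, K')\<leftarrow>D x.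
      if Q y then Re (mtrace ((K' * K) * X * adj (K' * K))) else 0)"
    unfolding outcome_prob_def instr_comp_def sum_list_concat_map
    by (simp add: case_prod_unfold comp_def cong: if_cong)
  also have "\<dots> = (\<Sum>(x, K)\<leftarrow>L. if Q x then Re (mtrace (K * X * adj K)) else 0)"
  proof (intro arg_cong[where f=sum_list] map_cong refl, clarify)
    fix x K assume "(x, K) \<in> set L"
    then have K: "K \<in> carrier_mat (c * d) (a * b)" using LOCC_carrier[OF assms(1)] by blast
    have "(\<Sum>(y, K')\<leftarrow>D x. if Q y then Re (mtrace ((K' * K) * X * adj (K' * K))) else 0) =
       (\<Sum>(y, K')\<leftarrow>D x. if Q x then Re (mtrace (K' * (K * X * adj K) * adj K')) else 0)"
    proof (intro arg_cong[where f=sum_list] map_cong refl, clarify)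
      fix y K' assume yK: "(y, K') \<in> set (D x)"
      show "(if Q y then Re (mtrace ((K' * K) * X * adj (K' * K))) else 0) =
          (if Q x then Re (mtrace (K' * (K * X * adj K) * adj K')) else 0)"
        unfolding conj_conj[OF LOCC_carrier[OF assms(3) yK] K assms(2)] assms(4)[OF yK] ..
    qed
    also have "\<dots> = (if Q x then outcome_prob (D x) (\<lambda>_. True) (K * X * adj K) else 0)"
      by (simp add: outcome_prob_def case_prod_unfold)
    also have "outcome_prob (D x) (\<lambda>_. True) (K * X * adj K) = Re (mtrace (K * X * adj K))"
      using K assms(2) by (intro outcome_prob_total[OF assms(3)]) auto
    finally show "(\<Sum>(y, K')\<leftarrow>D x. if Q y then Re (mtrace ((K' * K) * X * adj (K' * K))) else 0) =
      (if Q x then Re (mtrace (K * X * adj K)) else 0)" .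
  qed
  finally show ?thesis by (simp add: outcome_prob_def)
qed

text \<open>Positivity makes every trace real, so the complex modulus in the LOCC norm becomes an
  absolute difference of two probabilities.\<close>

lemma mtrace_povm:
  assumes "\<forall>(x, K) \<in> set L. K \<in> carrier_mat m n" "psd n X"
  shows "mtrace (povm n L y * X) = complex_of_real (outcome_prob L (\<lambda>x. x = y) X)"
proof -
  have X: "X \<in> carrier_mat n n" using assms(2) by (rule psd_carrier)
  let ?F = "filter (\<lambda>(x, K). x = y) L"
  have c: "M \<in> carrier_mat n n" if "M \<in> set (map (\<lambda>(x, K). adj K * K) ?F)" for M
  proof -
    obtain x K where "(x, K) \<in> set L" "M = adj K * K" using \<open>M \<in> _\<close> by auto
    with assms(1) show ?thesis by (auto intro!: mult_carrier_mat[where n=m] adjoint_carrier)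
  qed
  have c': "M \<in> carrier_mat n n" if "M \<in> set (map (\<lambda>M. M * X) (map (\<lambda>(x, K). adj K * K) ?F))" for M
  proof -
    obtain N where "N \<in> set (map (\<lambda>(x, K). adj K * K) ?F)" "M = N * X" using \<open>M \<in> _\<close> by auto
    then show ?thesis using mult_carrier_mat[OF c X] by blast
  qed
  have "mtrace (povm n L y * X) = sum_list (map mtrace (map (\<lambda>M. M * X) (map (\<lambda>(x, K). adj K * K) ?F)))"
    unfolding povm_def by (subst mult_msum_right[OF X], erule c, rule mtrace_msum, erule c')
  also have "\<dots> = (\<Sum>(x, K)\<leftarrow>?F. complex_of_real (Re (mtrace (K * X * adj K))))"
    unfolding map_map
  proof (intro arg_cong[where f=sum_list] map_cong refl, clarify)
    fix x K assume "(x, K) \<in> set ?F"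
    then have K: "K \<in> carrier_mat m n" using assms(1) by auto
    show "(mtrace \<circ> ((\<lambda>M. M * X) \<circ> (\<lambda>(x, K). adj K * K))) (x, K) = complex_of_real (Re (mtrace (K * X * adj K)))"
      using psd_mtrace(3)[OF psd_conj[OF assms(2) K]] mtrace_conj[OF K X] by simp
  qed
  also have "\<dots> = complex_of_real (outcome_prob L (\<lambda>x. x = y) X)"
    unfolding outcome_prob_def by (induction L) auto
  finally show ?thesis .
qed

text \<open>The first component of a label is the guess, with \<open>True\<close> standing for the
  second operator. The inputs may be unnormalised, which makes the quantity homogeneous in the
  memory.\<close>

definition success_prob :: "((bool \<times> 'a) \<times> complex mat) list \<Rightarrow> complex mat \<Rightarrow> complex mat \<Rightarrow> real" where
  "success_prob L X0 X1 = (outcome_prob L (\<lambda>x. \<not> fst x) X0 + outcome_prob L fst X1) / 2"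

section \<open>Optimal discrimination in a single round and the LOCC norm\<close>

locale separable_pair =
  fixes dA dB :: nat and \<rho>0 \<rho>1 :: "complex mat"
  assumes sep: "sep_cone dA dB \<rho>0" "sep_cone dA dB \<rho>1"
    and unit_trace: "mtrace \<rho>0 = 1" "mtrace \<rho>1 = 1"
begin

lemma carrier: "\<rho>0 \<in> carrier_mat (dA * dB) (dA * dB)" "\<rho>1 \<in> carrier_mat (dA * dB) (dA * dB)"
  using sep by (auto intro: sep_cone_carrier)

definition bias :: "(nat \<times> complex mat) list \<Rightarrow> real" where
  "bias L = (\<Sum>x \<in> fst ` set L. cmod (mtrace (povm (dA * dB) L x * (\<rho>0 - \<rho>1))))"

text \<open>Labels that do not occur contribute zero, so \<open>S\<close> may be larger than the set
  of labels. This is convenient after relabelling by guesses, when one of the two guesses may be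
  absent.\<close>

lemma bias_eq:
  assumes "LOCC dA dB 1 1 L" "finite S" "fst ` set L \<subseteq> S"
  shows "bias L = (\<Sum>x\<in>S. \<bar>outcome_prob L (\<lambda>y. y = x) \<rho>0 - outcome_prob L (\<lambda>y. y = x) \<rho>1\<bar>)"
proof -
  note K = LOCC_carriers[OF assms(1)]
  have "cmod (mtrace (povm (dA * dB) L x * (\<rho>0 - \<rho>1))) =
      \<bar>outcome_prob L (\<lambda>y. y = x) \<rho>0 - outcome_prob L (\<lambda>y. y = x) \<rho>1\<bar>" for x
  proof -
    have P: "povm (dA * dB) L x \<in> carrier_mat (dA * dB) (dA * dB)"
      unfolding povm_def using K by (auto intro!: msum_carrier mult_carrier_mat adjoint_carrier)
    have "mtrace (povm (dA * dB) L x * (\<rho>0 - \<rho>1)) =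
       mtrace (povm (dA * dB) L x * \<rho>0) - mtrace (povm (dA * dB) L x * \<rho>1)"
      unfolding mult_minus_distrib_mat[OF P carrier]
      using P carrier by (intro mtrace_minus) auto
    also have "\<dots> = complex_of_real (outcome_prob L (\<lambda>y. y = x) \<rho>0 - outcome_prob L (\<lambda>y. y = x) \<rho>1)"
      using mtrace_povm[OF K sep_cone_psd[OF sep(1)]] mtrace_povm[OF K sep_cone_psd[OF sep(2)]] by simp
    finally show ?thesis by (simp only: norm_of_real)
  qed
  then have "bias L = (\<Sum>x\<in>fst ` set L. \<bar>outcome_prob L (\<lambda>y. y = x) \<rho>0 - outcome_prob L (\<lambda>y. y = x) \<rho>1\<bar>)"
    unfolding bias_def by simp
  also have "\<dots> = (\<Sum>x\<in>S. \<bar>outcome_prob L (\<lambda>y. y = x) \<rho>0 - outcome_prob L (\<lambda>y. y = x) \<rho>1\<bar>)"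
  proof (rule sum.mono_neutral_left[OF assms(2,3)])
    have "outcome_prob L (\<lambda>y. y = x) X = 0" if "x \<notin> fst ` set L" for x X
      unfolding outcome_prob_def using that by (induction L) auto
    then show "\<forall>x\<in>S - fst ` set L. \<bar>outcome_prob L (\<lambda>y. y = x) \<rho>0 - outcome_prob L (\<lambda>y. y = x) \<rho>1\<bar> = 0"
      by simp
  qed
  finally show ?thesis .
qed

lemma total:
  assumes "LOCC dA dB c d L"
  shows "outcome_prob L (\<lambda>_. True) \<rho>0 = 1" "outcome_prob L (\<lambda>_. True) \<rho>1 = 1"
  using outcome_prob_total[OF assms] carrier unit_trace by auto

text \<open>The difference of two nonnegative numbers is at most their sum in absolute value, and
  the probabilities of each state add up to 1. The bound ensures that the \<open>Sup\<close> in the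
  LOCC norm is a genuine least upper bound.\<close>

lemma bias_le_2:
  assumes "LOCC dA dB 1 1 L"
  shows "bias L \<le> 2"
proof -
  let ?p = "\<lambda>x X. outcome_prob L (\<lambda>y. y = x) X"
  have nn: "0 \<le> ?p x \<rho>0" "0 \<le> ?p x \<rho>1" for x
    using outcome_prob_nonneg[OF LOCC_carriers[OF assms]] sep_cone_psd[OF sep(1)] sep_cone_psd[OF sep(2)] by blast+
  have "bias L = (\<Sum>x\<in>fst ` set L. \<bar>?p x \<rho>0 - ?p x \<rho>1\<bar>)"
    by (rule bias_eq[OF assms]) auto
  also have "\<dots> \<le> (\<Sum>x\<in>fst ` set L. ?p x \<rho>0 + ?p x \<rho>1)"
    using nn by (intro sum_mono) (smt (verit))
  also have "\<dots> = outcome_prob L (\<lambda>_. True) \<rho>0 + outcome_prob L (\<lambda>_. True) \<rho>1"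
    using outcome_prob_by_label[of "fst ` set L" L "\<lambda>_. True"] by (simp add: sum.distrib)
  also have "\<dots> = 2" using total[OF assms] by simp
  finally show ?thesis .
qed

lemma LOCC_norm_eq: "LOCC_norm dA dB (\<rho>0 - \<rho>1) = (SUP L\<in>{L. LOCC dA dB 1 1 L}. bias L)"
  unfolding LOCC_norm_def bias_def by (intro arg_cong[where f=Sup]) auto

lemma bdd_bias: "bdd_above (bias ` {L. LOCC dA dB 1 1 L})"
  using bias_le_2 by (intro bdd_aboveI[where M=2]) auto

lemma measurement_exists: "\<exists>L :: ('a \<times> complex mat) list. LOCC dA dB 1 1 L"
  by (rule LOCC_discard[of dA dB undefined]) (erule exI)

lemma P_LOCC_bounds: "1/2 \<le> P_LOCC dA dB \<rho>0 \<rho>1" "P_LOCC dA dB \<rho>0 \<rho>1 \<le> 1"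
proof -
  obtain L :: "(nat \<times> complex mat) list" where L: "LOCC dA dB 1 1 L" using measurement_exists by blast
  have "0 \<le> bias L" unfolding bias_def by (intro sum_nonneg) auto
  also have "\<dots> \<le> LOCC_norm dA dB (\<rho>0 - \<rho>1)"
    unfolding LOCC_norm_eq using L by (intro cSUP_upper bdd_bias) auto
  finally show "1/2 \<le> P_LOCC dA dB \<rho>0 \<rho>1" by (simp add: P_LOCC_def)
  have "LOCC_norm dA dB (\<rho>0 - \<rho>1) \<le> 2"
    unfolding LOCC_norm_eq using L bias_le_2 by (intro cSUP_least) auto
  then show "P_LOCC dA dB \<rho>0 \<rho>1 \<le> 1" by (simp add: P_LOCC_def)
qed

text \<open>Merging the outcomes by their guess gives a two-outcome measurement. Its bias is twice
  the absolute difference of the probabilities of guessing \<open>True\<close>, and the same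
  difference without absolute value equals
  \<open>2 * success_prob M \<rho>0 \<rho>1 - 1\<close>.\<close>

lemma success_prob_le_P_LOCC:
  fixes M :: "((bool \<times> nat) \<times> complex mat) list"
  assumes "LOCC dA dB 1 1 M"
  shows "success_prob M \<rho>0 \<rho>1 \<le> P_LOCC dA dB \<rho>0 \<rho>1"
proof -
  let ?f = "\<lambda>x :: bool \<times> nat. of_bool (fst x) :: nat"
  let ?L = "map (\<lambda>(x, K). (?f x, K)) M"
  have L: "LOCC dA dB 1 1 ?L" using LOCC_relabel[OF assms] .
  let ?p = "\<lambda>X. outcome_prob M fst X" and ?n = "\<lambda>X. outcome_prob M (\<lambda>x. \<not> fst x) X"
  have pn: "?p \<rho>0 + ?n \<rho>0 = 1" "?p \<rho>1 + ?n \<rho>1 = 1"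
    using total[OF assms] outcome_prob_compl[of M fst] by simp_all
  have "bias ?L = (\<Sum>x\<in>{0, 1}. \<bar>outcome_prob ?L (\<lambda>y. y = x) \<rho>0 - outcome_prob ?L (\<lambda>y. y = x) \<rho>1\<bar>)"
    by (rule bias_eq[OF L]) auto
  also have "\<dots> = \<bar>?n \<rho>0 - ?n \<rho>1\<bar> + \<bar>?p \<rho>0 - ?p \<rho>1\<bar>"
    unfolding outcome_prob_relabel by simp
  finally have "4 * (success_prob M \<rho>0 \<rho>1 - 1/2) \<le> bias ?L"
    using pn abs_ge_self[of "?n \<rho>0 - ?n \<rho>1"] abs_ge_minus_self[of "?p \<rho>0 - ?p \<rho>1"]
    unfolding success_prob_def by argo
  also have "\<dots> \<le> LOCC_norm dA dB (\<rho>0 - \<rho>1)"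
    unfolding LOCC_norm_eq using L by (intro cSUP_upper bdd_bias) auto
  finally show ?thesis by (simp add: P_LOCC_def)
qed

lemma P_LOCC_approx:
  assumes "r < P_LOCC dA dB \<rho>0 \<rho>1"
  obtains M :: "((bool \<times> nat) \<times> complex mat) list"
  where "LOCC dA dB 1 1 M" "r < success_prob M \<rho>0 \<rho>1"
proof -
  have "4 * (r - 1/2) < (SUP L\<in>{L. LOCC dA dB 1 1 L}. bias L)"
    using assms by (simp add: P_LOCC_def LOCC_norm_eq[symmetric])
  then obtain L where L: "LOCC dA dB 1 1 L" "4 * (r - 1/2) < bias L"
    using measurement_exists by (subst (asm) less_cSUP_iff[OF _ bdd_bias]) auto
  let ?p = "\<lambda>x X. outcome_prob L (\<lambda>y. y = x) X"
  let ?S = "fst ` set L"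
  \<comment> \<open>Maximum likelihood, with ties resolved in favour of \<open>\<rho>0\<close>.
    Twice the larger of u and v is u + v + |u - v|, which turns four times the success probability
    into \<open>2 + bias L\<close>.\<close>
  define g where "g x = ((?p x \<rho>0 < ?p x \<rho>1), 0 :: nat)" for x
  define M where "M = map (\<lambda>(x, K). (g x, K)) L"
  have label: "outcome_prob L Q X = (\<Sum>x\<in>?S. if Q x then ?p x X else 0)" for Q X
    by (rule outcome_prob_by_label) auto
  have M: "LOCC dA dB 1 1 M" unfolding M_def using L(1) by (rule LOCC_relabel)
  have "4 * success_prob M \<rho>0 \<rho>1 = 2 * (\<Sum>x\<in>?S. (if \<not> fst (g x) then ?p x \<rho>0 else 0) + (if fst (g x) then ?p x \<rho>1 else 0))"
    unfolding success_prob_def M_def outcome_prob_relabel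
    by (simp add: label[of "\<lambda>x. \<not> fst (g x)"] label[of "\<lambda>x. fst (g x)"] sum.distrib)
  also have "\<dots> = (\<Sum>x\<in>?S. (?p x \<rho>0 + ?p x \<rho>1) + \<bar>?p x \<rho>0 - ?p x \<rho>1\<bar>)"
    unfolding sum_distrib_left by (intro sum.cong refl) (simp add: g_def abs_if)
  also have "\<dots> = outcome_prob L (\<lambda>_. True) \<rho>0 + outcome_prob L (\<lambda>_. True) \<rho>1 + bias L"
    using bias_eq[OF L(1), of ?S] by (simp add: label[of "\<lambda>_. True"] sum.distrib)
  also have "\<dots> = 2 + bias L" using total[OF L(1)] by simp
  finally have "r < success_prob M \<rho>0 \<rho>1" using L(2) by argo
  with M show ?thesis using that by blast
qed

lemma success_prob_le_1:
  assumes "LOCC dA dB c d M"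
  shows "success_prob M \<rho>0 \<rho>1 \<le> 1"
proof -
  have "0 \<le> outcome_prob M Q \<rho>0" "0 \<le> outcome_prob M Q \<rho>1" for Q
    using outcome_prob_nonneg[OF LOCC_carriers[OF assms]] sep_cone_psd[OF sep(1)] sep_cone_psd[OF sep(2)] by blast+
  from this[of fst] this[of "\<lambda>x. \<not> fst x"]
  show ?thesis
    using total[OF assms] outcome_prob_compl[of M fst \<rho>0] outcome_prob_compl[of M fst \<rho>1]
    unfolding success_prob_def by simp
qed

end

section \<open>A single round with a separable memory\<close>

lemma normalize_col:
  assumes "\<alpha> \<in> carrier_mat n 1" "0 < n"
  obtains c :: real and \<gamma> where "0 \<le> c" "\<gamma> \<in> carrier_mat n 1" "adj \<gamma> * \<gamma> = 1\<^sub>m 1" "\<alpha> = complex_of_real c \<cdot>\<^sub>m \<gamma>"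
proof -
  define s where "s = (\<Sum>i<n. (cmod (\<alpha> $$ (i, 0)))\<^sup>2)"
  have s0: "0 \<le> s" unfolding s_def by (intro sum_nonneg) auto
  have gram: "(adj \<gamma> * \<gamma>) $$ (0, 0) = complex_of_real (\<Sum>i<n. (cmod (\<gamma> $$ (i, 0)))\<^sup>2)"
    if "\<gamma> \<in> carrier_mat n 1" for \<gamma>
    using that by (subst index_mult_sum) (auto simp: complex_norm_square mult.commute simp del: of_real_power)
  show ?thesis
  proof (cases "s = 0")
    case True
    \<comment> \<open>The zero vector is zero times any unit vector; the first basis vector is
      taken, and it exists because \<open>0 < n\<close>.\<close>
    let ?\<gamma> = "mat n 1 (\<lambda>(k, _). if k = 0 then 1 else 0) :: complex mat"
    have "\<alpha> $$ (i, 0) = 0" if "i < n" for i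
      using True that unfolding s_def by (subst (asm) sum_nonneg_eq_0_iff) auto
    then have "\<alpha> = complex_of_real 0 \<cdot>\<^sub>m ?\<gamma>"
      using assms(1) by (intro eq_matI) auto
    moreover have "(\<Sum>i<n. (cmod (?\<gamma> $$ (i, 0)))\<^sup>2) = (\<Sum>i<n. if i = 0 then 1 else 0)"
      by (intro sum.cong) auto
    then have "adj ?\<gamma> * ?\<gamma> = 1\<^sub>m 1"
      using gram[of ?\<gamma>] assms(2) by (intro eq_matI) auto
    ultimately show ?thesis using that[of 0 ?\<gamma>] by auto
  next
    case False
    let ?\<gamma> = "complex_of_real (1 / sqrt s) \<cdot>\<^sub>m \<alpha>"
    have c: "?\<gamma> \<in> carrier_mat n 1" using assms(1) by simp
    have "(\<Sum>i<n. (cmod (?\<gamma> $$ (i, 0)))\<^sup>2) = (\<Sum>i<n. (cmod (\<alpha> $$ (i, 0)))\<^sup>2 / s)"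
      using assms(1) s0 by (intro sum.cong) (auto simp: norm_mult norm_divide power_divide)
    also have "\<dots> = 1" using False by (simp add: s_def[symmetric] sum_divide_distrib[symmetric])
    finally have "adj ?\<gamma> * ?\<gamma> = 1\<^sub>m 1"
      using gram[OF c] assms(1) by (intro eq_matI) (auto simp del: index_mult_mat(1))
    moreover have "\<alpha> = complex_of_real (sqrt s) \<cdot>\<^sub>m ?\<gamma>"
      using assms(1) False s0 by (intro eq_matI) (auto simp flip: of_real_mult)
    ultimately show ?thesis using that[of "sqrt s" ?\<gamma>] c s0 by simp
  qed
qed

text \<open>The memory is factored through the trivial system 1|1, where it is the scalar 1.
  Attaching a pure product memory becomes conjugation by a product of local maps, which are
  isometries when the two vectors are normalised.\<close>

lemma bstate_pure_memory:
  assumes "X \<in> carrier_mat (A * B) (A * B)" "\<alpha> \<in> carrier_mat a 1" "\<beta> \<in> carrier_mat b 1"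
  shows "bstate A B a b X (kron \<alpha> \<beta> * adj (kron \<alpha> \<beta>)) =
    kron (kron (1\<^sub>m A) \<alpha>) (kron (1\<^sub>m B) \<beta>) * X * adj (kron (kron (1\<^sub>m A) \<alpha>) (kron (1\<^sub>m B) \<beta>))"
proof -
  let ?G = "kron \<alpha> \<beta>"
  have G: "?G \<in> carrier_mat (a * b) (1 * 1)" using assms by (auto intro!: kron_carrier simp del: mult_1)
  have W: "kron (kron (1\<^sub>m A) \<alpha>) (kron (1\<^sub>m B) \<beta>) = btensor A B A B a b 1 1 (1\<^sub>m (A * B)) ?G"
    unfolding kron_one[symmetric] using assms by (intro btensor_kron[symmetric]) auto
  have "bstate A B a b X (?G * adj ?G) = bstate A B a b (1\<^sub>m (A * B) * X * 1\<^sub>m (A * B)) (?G * 1\<^sub>m 1 * adj ?G)"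
    using assms(1) right_mult_one_mat[OF G] by simp
  also have "\<dots> = btensor A B A B a b 1 1 (1\<^sub>m (A * B) * X) (?G * 1\<^sub>m 1) * btensor A B A B 1 1 a b (1\<^sub>m (A * B)) (adj ?G)"
    using assms G by (intro btensor_mult[symmetric]) (auto intro!: adjoint_carrier simp: right_mult_one_mat)
  also have "btensor A B A B a b 1 1 (1\<^sub>m (A * B) * X) (?G * 1\<^sub>m 1) =
      btensor A B A B a b 1 1 (1\<^sub>m (A * B)) ?G * btensor A B A B 1 1 1 1 X (1\<^sub>m 1)"
    using assms G by (intro btensor_mult[symmetric]) auto
  also have "btensor A B A B 1 1 1 1 X (1\<^sub>m 1) = X" using assms(1) by (rule btensor_one_right)
  also have "btensor A B A B 1 1 a b (1\<^sub>m (A * B)) (adj ?G) = adj (btensor A B A B a b 1 1 (1\<^sub>m (A * B)) ?G)"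
    using G by (subst adjoint_btensor) auto
  finally show ?thesis by (simp only: W)
qed

context separable_pair
begin

lemma success_prob_product_memory:
  fixes L :: "((bool \<times> nat) \<times> complex mat) list"
  assumes L: "LOCC (dA * a) (dB * b) c d L"
    and \<alpha>: "\<alpha> \<in> carrier_mat a 1" "adj \<alpha> * \<alpha> = 1\<^sub>m 1"
    and \<beta>: "\<beta> \<in> carrier_mat b 1" "adj \<beta> * \<beta> = 1\<^sub>m 1"
  shows "success_prob L (bstate dA dB a b \<rho>0 (kron \<alpha> \<beta> * adj (kron \<alpha> \<beta>)))
    (bstate dA dB a b \<rho>1 (kron \<alpha> \<beta> * adj (kron \<alpha> \<beta>))) \<le> P_LOCC dA dB \<rho>0 \<rho>1"
proof -
  let ?E = "kron (1\<^sub>m dA) \<alpha>" and ?F = "kron (1\<^sub>m dB) \<beta>"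
  let ?W = "kron ?E ?F"
  have E: "?E \<in> carrier_mat (dA * a) dA" "?F \<in> carrier_mat (dB * b) dB"
    using kron_carrier[OF one_carrier_mat \<alpha>(1), of dA] kron_carrier[OF one_carrier_mat \<beta>(1), of dB] by simp_all
  have iso: "adj ?E * ?E = 1\<^sub>m dA" "adj ?F * ?F = 1\<^sub>m dB"
    using \<alpha> \<beta> by (simp_all add: adjoint_kron kron_mult)
  let ?L1 = "map (\<lambda>(x, K). (x, K * ?W)) L"
  have L1: "LOCC dA dB c d ?L1" by (rule LOCC_prepend[OF E(1) iso(1) E(2) iso(2) L])
  \<comment> \<open>The discarding step has to hand on the guess, so one such measurement is chosen
    for each label.\<close>
  have "\<exists>D. LOCC c d 1 1 D \<and> (\<forall>y K. (y, K) \<in> set D \<longrightarrow> y = x)" for x :: "bool \<times> nat"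
    by (rule LOCC_discard[of c d x], intro exI conjI, assumption) simp
  from choice[OF allI[OF this]]
  obtain D where D': "\<forall>x :: bool \<times> nat. LOCC c d 1 1 (D x) \<and> (\<forall>y K. (y, K) \<in> set (D x) \<longrightarrow> y = x)" ..
  have D: "LOCC c d 1 1 (D x)" "(y, K) \<in> set (D x) \<Longrightarrow> y = x" for x y K
    using spec[OF D', of x] by blast+
  have eq: "outcome_prob (instr_comp ?L1 D) Q X = outcome_prob L Q (bstate dA dB a b X (kron \<alpha> \<beta> * adj (kron \<alpha> \<beta>)))"
    if X: "X \<in> carrier_mat (dA * dB) (dA * dB)" for Q X
  proof -
    have "outcome_prob (instr_comp ?L1 D) Q X = outcome_prob ?L1 Q X"
      by (rule outcome_prob_comp[OF L1 X D])
    also have "\<dots> = outcome_prob L Q (?W * X * adj ?W)"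
      by (rule outcome_prob_conj[OF LOCC_carriers[OF L] kron_carrier[OF E] X])
    finally show ?thesis unfolding bstate_pure_memory[OF X \<alpha>(1) \<beta>(1)] .
  qed
  have "success_prob (instr_comp ?L1 D) \<rho>0 \<rho>1 \<le> P_LOCC dA dB \<rho>0 \<rho>1"
    by (rule success_prob_le_P_LOCC[OF LOCC_comp[OF L1]]) (rule D(1))
  then show ?thesis unfolding success_prob_def eq[OF carrier(1)] eq[OF carrier(2)] .
qed

text \<open>Both sides are additive over the cone, so each generator is treated separately: rescaled
  to unit vectors it is a normalised product memory with weight \<open>(s * t)\<^sup>2\<close>,
  which is also its trace.\<close>

lemma success_prob_separable_memory:
  fixes L :: "((bool \<times> nat) \<times> complex mat) list"
  assumes L: "LOCC (dA * a) (dB * b) c d L" and pos: "0 < a" "0 < b" and "sep_cone a b \<sigma>"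
  shows "success_prob L (bstate dA dB a b \<rho>0 \<sigma>) (bstate dA dB a b \<rho>1 \<sigma>) \<le> P_LOCC dA dB \<rho>0 \<rho>1 * Re (mtrace \<sigma>)"
  using assms(4)
proof (induction rule: sep_cone.induct)
  case zero
  show ?case
    unfolding btensor_zero_right success_prob_def
    using outcome_prob_zero[OF LOCC_carriers[OF L]] by simp
next
  case (add \<alpha> \<beta> Y)
  note K = LOCC_carriers[OF L]
  let ?B = "\<lambda>X. bstate dA dB a b X"
  let ?P = "P_LOCC dA dB \<rho>0 \<rho>1"
  obtain s \<gamma> where s: "0 \<le> s" "\<gamma> \<in> carrier_mat a 1" "adj \<gamma> * \<gamma> = 1\<^sub>m 1" "\<alpha> = complex_of_real s \<cdot>\<^sub>m \<gamma>"
    using normalize_col[OF add(1) pos(1)] .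
  obtain t \<delta> where t: "0 \<le> t" "\<delta> \<in> carrier_mat b 1" "adj \<delta> * \<delta> = 1\<^sub>m 1" "\<beta> = complex_of_real t \<cdot>\<^sub>m \<delta>"
    using normalize_col[OF add(2) pos(2)] .
  let ?G = "kron \<alpha> \<beta> * adj (kron \<alpha> \<beta>)" and ?H = "kron \<gamma> \<delta> * adj (kron \<gamma> \<delta>)"
  have Hc: "kron \<gamma> \<delta> \<in> carrier_mat (a * b) 1" using s t by (intro kron_col_carrier)
  have H: "?H \<in> carrier_mat (a * b) (a * b)" by (rule outer_carrier[OF Hc])
  have G: "?G = complex_of_real ((s * t)\<^sup>2) \<cdot>\<^sub>m ?H"
  proof -
    have "kron \<alpha> \<beta> = complex_of_real (s * t) \<cdot>\<^sub>m kron \<gamma> \<delta>" unfolding s(4) t(4) kron_smult by simp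
    then show ?thesis
      using Hc by (auto intro!: eq_matI simp: adjoint_smult index_mult_sum sum_distrib_left power2_eq_square mult_ac
          simp del: index_mult_mat(1))
  qed
  have trH: "mtrace ?H = 1"
  proof -
    have "mtrace ?H = mtrace (adj (kron \<gamma> \<delta>) * kron \<gamma> \<delta>)"
      using Hc by (intro mtrace_comm[where n="a * b" and m=1]) auto
    also have "adj (kron \<gamma> \<delta>) * kron \<gamma> \<delta> = 1\<^sub>m 1"
      using s(2,3) t(2,3) by (simp add: adjoint_kron kron_mult)
    finally show ?thesis by (simp add: mtrace_def)
  qed
  have add_prob: "success_prob L (?B \<rho>0 (?G + Y)) (?B \<rho>1 (?G + Y)) =
      (s * t)\<^sup>2 * success_prob L (?B \<rho>0 ?H) (?B \<rho>1 ?H) + success_prob L (?B \<rho>0 Y) (?B \<rho>1 Y)"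
  proof -
    have Gc: "?G \<in> carrier_mat (a * b) (a * b)" unfolding G using H by simp
    have "outcome_prob L Q (?B X (?G + Y)) = (s * t)\<^sup>2 * outcome_prob L Q (?B X ?H) + outcome_prob L Q (?B X Y)" for Q X
    proof -
      have "outcome_prob L Q (?B X (?G + Y)) = outcome_prob L Q (?B X ?G) + outcome_prob L Q (?B X Y)"
        unfolding btensor_add_right[OF Gc sep_cone_carrier[OF add(3)]]
        by (rule outcome_prob_add[OF K btensor_carrier btensor_carrier])
      also have "outcome_prob L Q (?B X ?G) = (s * t)\<^sup>2 * outcome_prob L Q (?B X ?H)"
        unfolding G btensor_smult_right[OF H] by (rule outcome_prob_smult[OF K btensor_carrier])
      finally show ?thesis .
    qed
    then show ?thesis by (simp add: success_prob_def field_simps)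
  qed
  have "mtrace (?G + Y) = complex_of_real ((s * t)\<^sup>2) + mtrace Y"
    unfolding G using H trH sep_cone_carrier[OF add(3)]
    by (simp add: mtrace_add[where n="a * b"] mtrace_smult[where n="a * b"])
  then have "?P * Re (mtrace (?G + Y)) = (s * t)\<^sup>2 * ?P + ?P * Re (mtrace Y)"
    by (simp add: algebra_simps)
  moreover have "(s * t)\<^sup>2 * success_prob L (?B \<rho>0 ?H) (?B \<rho>1 ?H) \<le> (s * t)\<^sup>2 * ?P"
    by (intro mult_left_mono success_prob_product_memory[OF L s(2,3) t(2,3)]) simp
  ultimately show ?case using add(4) unfolding add_prob by linarith
qed

end

section \<open>Repeated discrimination\<close>

text \<open>The usual Chernoff argument, for a function \<open>f\<close> obeying the recursion of \<^const>\<open>disc_run\<close>;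
  \<open>t > 0\<close> bounds the upper tail and \<open>t < 0\<close> the lower tail of the number of correct guesses.\<close>

lemma exp_moment_bound:
  fixes f :: "nat \<Rightarrow> (bool \<times> nat) list \<Rightarrow> complex mat \<Rightarrow> nat \<Rightarrow> real"
    and B :: "bool \<Rightarrow> complex mat \<Rightarrow> complex mat"
  assumes f0: "\<And>h \<sigma> c. Cone \<sigma> \<Longrightarrow> f 0 h \<sigma> c \<le> exp (t * (real c - thr)) * Re (mtrace \<sigma>)"
    and fS: "\<And>m h \<sigma> c. Cone \<sigma> \<Longrightarrow> f (Suc m) h \<sigma> c =
      (\<Sum>z\<in>UNIV. 1/2 * (\<Sum>(x, K)\<leftarrow>L h. f m (h @ [x]) (K * B z \<sigma> * adj K) (if fst x = z then Suc c else c)))"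
    and closed: "\<And>h x K z \<sigma>. Cone \<sigma> \<Longrightarrow> (x, K) \<in> set (L h) \<Longrightarrow> Cone (K * B z \<sigma> * adj K)"
    and tp: "\<And>h z \<sigma>. Cone \<sigma> \<Longrightarrow> outcome_prob (L h) (\<lambda>_. True) (B z \<sigma>) = Re (mtrace \<sigma>)"
    and succ: "\<And>h \<sigma>. Cone \<sigma> \<Longrightarrow>
      (exp t - 1) * success_prob (L h) (B False \<sigma>) (B True \<sigma>) \<le> (exp t - 1) * (P * Re (mtrace \<sigma>))"
    and q: "0 \<le> 1 + P * (exp t - 1)"
    and \<sigma>: "Cone \<sigma>"
  shows "f m h \<sigma> c \<le> exp (t * (real c - thr)) * (1 + P * (exp t - 1)) ^ m * Re (mtrace \<sigma>)"
  using \<sigma>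
proof (induction m arbitrary: h \<sigma> c)
  case 0
  then show ?case using f0 by simp
next
  case (Suc m)
  define e where "e = exp (t * (real c - thr)) * (1 + P * (exp t - 1)) ^ m"
  have e0: "0 \<le> e" unfolding e_def using q by simp
  \<comment> \<open>A correct guess multiplies the bound by \<open>exp t\<close>, that is, it adds
    \<open>exp t - 1\<close> times the weight of the correct outcomes. Averaging over
    \<open>z\<close> turns these weights into \<open>success_prob\<close>.\<close>
  have branch: "(\<Sum>(x, K)\<leftarrow>L h. f m (h @ [x]) (K * B z \<sigma> * adj K) (if fst x = z then Suc c else c)) \<le>
      e * (Re (mtrace \<sigma>) + (exp t - 1) * outcome_prob (L h) (\<lambda>x. fst x = z) (B z \<sigma>))" for z
  proof -
    have "(\<Sum>(x, K)\<leftarrow>L h. f m (h @ [x]) (K * B z \<sigma> * adj K) (if fst x = z then Suc c else c)) \<le>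
        (\<Sum>(x, K)\<leftarrow>L h. e * (if fst x = z then exp t else 1) * Re (mtrace (K * B z \<sigma> * adj K)))"
    proof (rule sum_list_mono, clarify)
      fix y1 y2 K assume K: "((y1, y2), K) \<in> set (L h)"
      have "exp (t * (real (Suc c) - thr)) = exp (t * (real c - thr)) * exp t"
        by (simp add: exp_add[symmetric] algebra_simps)
      then have "exp (t * (real (if y1 = z then Suc c else c) - thr)) * (1 + P * (exp t - 1)) ^ m =
          e * (if y1 = z then exp t else 1)"
        by (simp add: e_def)
      then show "f m (h @ [(y1, y2)]) (K * B z \<sigma> * adj K) (if fst (y1, y2) = z then Suc c else c) \<le>
          e * (if fst (y1, y2) = z then exp t else 1) * Re (mtrace (K * B z \<sigma> * adj K))"
        using Suc.IH[OF closed[OF Suc.prems K, of z], of "h @ [(y1, y2)]" "if y1 = z then Suc c else c"]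
        by (simp only: fst_conv)
    qed
    also have "\<dots> = e * (outcome_prob (L h) (\<lambda>_. True) (B z \<sigma>) + (exp t - 1) * outcome_prob (L h) (\<lambda>x. fst x = z) (B z \<sigma>))"
    proof -
      have "(\<Sum>(x, K)\<leftarrow>M. e * (if fst x = z then exp t else 1) * Re (mtrace (K * B z \<sigma> * adj K))) =
          e * (outcome_prob M (\<lambda>_. True) (B z \<sigma>) + (exp t - 1) * outcome_prob M (\<lambda>x. fst x = z) (B z \<sigma>))"
        for M :: "((bool \<times> nat) \<times> complex mat) list"
        unfolding outcome_prob_def by (induction M) (auto simp: algebra_simps)
      then show ?thesis .
    qed
    finally show ?thesis by (simp only: tp[OF Suc.prems])
  qed
  have "f (Suc m) h \<sigma> c \<le> (\<Sum>z\<in>UNIV. 1/2 * (e * (Re (mtrace \<sigma>) + (exp t - 1) * outcome_prob (L h) (\<lambda>x. fst x = z) (B z \<sigma>))))"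
    unfolding fS[OF Suc.prems] using branch by (intro sum_mono mult_left_mono) auto
  also have "\<dots> = e * (Re (mtrace \<sigma>) + (exp t - 1) * success_prob (L h) (B False \<sigma>) (B True \<sigma>))"
    by (simp add: UNIV_bool success_prob_def field_simps)
  \<comment> \<open>The factor \<open>exp t - 1\<close> inside \<open>succ\<close> fixes its
    direction: an upper bound on the success probability for positive \<open>t\<close>, a lower
    bound for negative \<open>t\<close>.\<close>
  also have "\<dots> \<le> e * (Re (mtrace \<sigma>) + (exp t - 1) * (P * Re (mtrace \<sigma>)))"
    using succ[OF Suc.prems] e0 by (intro mult_left_mono) auto
  also have "\<dots> = exp (t * (real c - thr)) * (1 + P * (exp t - 1)) ^ Suc m * Re (mtrace \<sigma>)"
    by (simp add: e_def algebra_simps)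
  finally show ?case .
qed

section \<open>Chernoff estimates\<close>

lemma exp_le_quadratic:
  fixes t :: real
  assumes "t \<le> 1"
  shows "exp t \<le> 1 + t + t\<^sup>2"
proof (cases "0 \<le> t")
  case True
  then show ?thesis using exp_bound assms by blast
next
  case False
  have "exp t * (1 - t) \<le> exp t * exp (- t)"
    using exp_ge_add_one_self[of "- t"] by (intro mult_left_mono) auto
  also have "\<dots> = 1" by (simp add: exp_minus)
  \<comment> \<open>The product is \<open>1 - t ^ 3\<close>, and \<open>t\<close> is negative in
    this case.\<close>
  also have "1 \<le> (1 + t + t\<^sup>2) * (1 - t)"
    using False by (simp add: algebra_simps power2_eq_square mult_nonneg_nonpos2 mult_nonneg_nonpos)
  finally show ?thesis using False by simp
qed

text \<open>With \<open>exp t - 1\<close> replaced by its quadratic bound and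
  \<open>P \<le> 1\<close>, the exponent is at most \<open>t\<^sup>2 - (r - P) * t\<close>. Its
  minimum is at \<open>t = (r - P) / 2\<close>, with value \<open>- ((r - P)\<^sup>2 / 4)\<close>.
  The sign of \<open>r - P\<close> is free, so both tails are covered; \<open>r \<le> P + 1\<close>
  keeps \<open>t\<close> in the range of the quadratic bound.\<close>

lemma chernoff_rate:
  fixes P r :: real
  assumes "0 \<le> P" "P \<le> 1" "r \<le> P + 1" and t: "t = (r - P) / 2"
  shows "(1 + P * (exp t - 1)) * exp (- (t * r)) \<le> exp (- ((r - P)\<^sup>2 / 4))"
proof -
  have "1 + P * (exp t - 1) \<le> exp (P * (exp t - 1))" by (rule exp_ge_add_one_self)
  also have "\<dots> \<le> exp (P * (t + t\<^sup>2))"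
  proof -
    have "t \<le> 1" using assms by simp
    from exp_le_quadratic[OF this] show ?thesis using assms(1) by (auto intro!: mult_left_mono)
  qed
  finally have "(1 + P * (exp t - 1)) * exp (- (t * r)) \<le> exp (P * (t + t\<^sup>2)) * exp (- (t * r))"
    by (intro mult_right_mono) auto
  also have "\<dots> = exp (P * (t + t\<^sup>2) - t * r)" by (simp add: exp_add[symmetric])
  also have "P * (t + t\<^sup>2) - t * r = (P - 2) * t\<^sup>2"
    unfolding t by (simp add: field_simps power2_eq_square)
  also have "exp ((P - 2) * t\<^sup>2) \<le> exp (- t\<^sup>2)"
    using mult_right_mono[of "P - 2" "-1" "t\<^sup>2"] assms(2) by simp
  also have "- t\<^sup>2 = - ((r - P)\<^sup>2 / 4)" unfolding t by (simp add: power_divide)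
  finally show ?thesis .
qed

lemma moment_factor_nonneg:
  assumes "0 \<le> P" "P \<le> (1::real)"
  shows "0 \<le> 1 + P * (exp t - 1)"
proof -
  have "P * (exp t - 1) \<ge> P * (- 1)" using assms(1) by (intro mult_left_mono) auto
  then show ?thesis using assms(2) by simp
qed

lemma chernoff_power:
  fixes P r :: real
  assumes "0 \<le> P" "P \<le> 1" "r \<le> P + 1" and t: "t = (r - P) / 2"
  shows "exp (t * (0 - r * real n)) * (1 + P * (exp t - 1)) ^ n \<le> exp (- ((r - P)\<^sup>2 / 4)) ^ n"
proof -
  have "exp (t * (0 - r * real n)) * (1 + P * (exp t - 1)) ^ n = ((1 + P * (exp t - 1)) * exp (- (t * r))) ^ n"
    by (simp add: power_mult_distrib exp_of_nat_mult[symmetric] mult_ac)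
  also have "\<dots> \<le> exp (- ((r - P)\<^sup>2 / 4)) ^ n"
    using chernoff_rate[OF assms] moment_factor_nonneg[OF assms(1,2)] by (intro power_mono) auto
  finally show ?thesis .
qed

section \<open>Runs with a memory and the upper bound on their rate\<close>

context separable_pair
begin

abbreviation "sent z \<equiv> if z then \<rho>1 else \<rho>0"

lemma sent: "sep_cone dA dB (sent z)" "sent z \<in> carrier_mat (dA * dB) (dA * dB)" "mtrace (sent z) = 1"
  using sep carrier unit_trace by auto

text \<open>The strategy sees only the labels and never the memory operator, so every branch of the
  recursion is additive in that operator.\<close>

lemma disc_run_add:
  assumes "\<And>h. LOCC (dA * a) (dB * b) a b (L h)"
    "\<sigma> \<in> carrier_mat (a * b) (a * b)" "\<tau> \<in> carrier_mat (a * b) (a * b)"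
  shows "disc_run dA dB a b \<rho>0 \<rho>1 L thr m h (\<sigma> + \<tau>) c =
    disc_run dA dB a b \<rho>0 \<rho>1 L thr m h \<sigma> c + disc_run dA dB a b \<rho>0 \<rho>1 L thr m h \<tau> c"
  using assms(2,3)
proof (induction m arbitrary: h \<sigma> \<tau> c)
  case 0
  then show ?case by (simp add: mtrace_add[where n="a * b"])
next
  case (Suc m)
  let ?D = "disc_run dA dB a b \<rho>0 \<rho>1 L thr m"
  let ?c = "\<lambda>x z. if fst x = z then Suc c else c"
  have "(\<Sum>(x, K)\<leftarrow>L h. ?D (h @ [x]) (K * bstate dA dB a b (sent z) (\<sigma> + \<tau>) * adj K) (?c x z)) =
     (\<Sum>(x, K)\<leftarrow>L h. ?D (h @ [x]) (K * bstate dA dB a b (sent z) \<sigma> * adj K) (?c x z)) +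
     (\<Sum>(x, K)\<leftarrow>L h. ?D (h @ [x]) (K * bstate dA dB a b (sent z) \<tau> * adj K) (?c x z))" for z
  proof -
    have "?D (h @ [x]) (K * bstate dA dB a b (sent z) (\<sigma> + \<tau>) * adj K) (?c x z) =
        ?D (h @ [x]) (K * bstate dA dB a b (sent z) \<sigma> * adj K) (?c x z) +
        ?D (h @ [x]) (K * bstate dA dB a b (sent z) \<tau> * adj K) (?c x z)" if "(x, K) \<in> set (L h)" for x K
    proof -
      have K: "K \<in> carrier_mat (a * b) (dA * a * (dB * b))" using LOCC_carrier[OF assms(1) that] .
      show ?thesis
        unfolding btensor_add_right[OF Suc.prems] conj_add[OF K btensor_carrier btensor_carrier]
        by (rule Suc.IH; intro mult_carrier_mat[OF mult_carrier_mat[OF K btensor_carrier] adjoint_carrier[OF K]])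
    qed
    then show ?thesis
      unfolding sum_list_addf[symmetric]
      by (intro arg_cong[where f=sum_list] map_cong refl) auto
  qed
  then show ?case by (simp add: sum.distrib distrib_left)
qed

text \<open>Stated on all positive semidefinite memories because it is applied to the difference of
  the identity and a possibly entangled state. The received states are separable, so
  \<open>psd_bstate\<close> carries positivity through a round.\<close>

lemma disc_run_nonneg:
  assumes "\<And>h. LOCC (dA * a) (dB * b) a b (L h)" "psd (a * b) \<sigma>"
  shows "0 \<le> disc_run dA dB a b \<rho>0 \<rho>1 L thr m h \<sigma> c"
  using assms(2)
proof (induction m arbitrary: h \<sigma> c)
  case 0
  then show ?case using psd_mtrace(2) by simp
next
  case (Suc m)
  have "0 \<le> (\<Sum>(x, K)\<leftarrow>L h. disc_run dA dB a b \<rho>0 \<rho>1 L thr m (h @ [x])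
      (K * bstate dA dB a b (sent z) \<sigma> * adj K) (if fst x = z then Suc c else c))" for z
  proof (intro sum_list_nonneg, clarsimp simp del: disc_run.simps split del: if_split)
    fix y1 y2 K assume "((y1, y2), K) \<in> set (L h)"
    from psd_conj[OF psd_bstate[OF sent(1) Suc.prems] LOCC_carrier[OF assms(1) this]]
    show "0 \<le> disc_run dA dB a b \<rho>0 \<rho>1 L thr m (h @ [(y1, y2)])
      (K * bstate dA dB a b (sent z) \<sigma> * adj K) (if y1 = z then Suc c else c)"
      by (rule Suc.IH)
  qed
  then show ?case unfolding disc_run.simps by (intro sum_nonneg mult_nonneg_nonneg) auto
qed

lemma disc_run_le_uniform_memory:
  assumes "\<And>h. LOCC (dA * a) (dB * b) a b (L h)" "density (a * b) \<mu>"
  shows "disc_run dA dB a b \<rho>0 \<rho>1 L thr m h \<mu> c \<le> disc_run dA dB a b \<rho>0 \<rho>1 L thr m h (1\<^sub>m (a * b)) c"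
proof -
  have \<mu>: "psd (a * b) \<mu>" "mtrace \<mu> = 1" using assms(2) by (auto simp: density_def)
  have c: "\<mu> \<in> carrier_mat (a * b) (a * b)" "1\<^sub>m (a * b) - \<mu> \<in> carrier_mat (a * b) (a * b)"
    using psd_carrier[OF \<mu>(1)] psd_carrier[OF psd_one_minus[OF \<mu>]] by auto
  have "1\<^sub>m (a * b) = \<mu> + (1\<^sub>m (a * b) - \<mu>)" using c(1) by (intro eq_matI) auto
  then have "disc_run dA dB a b \<rho>0 \<rho>1 L thr m h (1\<^sub>m (a * b)) c =
     disc_run dA dB a b \<rho>0 \<rho>1 L thr m h \<mu> c + disc_run dA dB a b \<rho>0 \<rho>1 L thr m h (1\<^sub>m (a * b) - \<mu>) c"
    using disc_run_add[OF assms(1) c] by simp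
  then show ?thesis using disc_run_nonneg[OF assms(1) psd_one_minus[OF \<mu>]] by simp
qed

lemma outcome_prob_bstate:
  assumes "LOCC (dA * a) (dB * b) c d L" "\<sigma> \<in> carrier_mat (a * b) (a * b)"
  shows "outcome_prob L (\<lambda>_. True) (bstate dA dB a b (sent z) \<sigma>) = Re (mtrace \<sigma>)"
  using outcome_prob_total[OF assms(1) btensor_carrier] mtrace_bstate[OF sent(2) assms(2)] sent(3)
  by simp

text \<open>For \<open>0 \<le> t\<close> the exponential dominates the indicator of
  \<open>thr \<le> real c\<close>, which starts the moment estimate at the end of the run. The
  separable cone is closed under rounds, and on it each round obeys the one-round bound.\<close>

lemma disc_run_separable_memory:
  assumes "\<And>h. LOCC (dA * a) (dB * b) a b (L h)" "0 < a" "0 < b" "sep_cone a b \<sigma>" "0 \<le> t"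
  shows "disc_run dA dB a b \<rho>0 \<rho>1 L thr m h \<sigma> c \<le>
    exp (t * (real c - thr)) * (1 + P_LOCC dA dB \<rho>0 \<rho>1 * (exp t - 1)) ^ m * Re (mtrace \<sigma>)"
proof (rule exp_moment_bound[where Cone="sep_cone a b" and B="\<lambda>z. bstate dA dB a b (sent z)" and L=L])
  fix h \<sigma> c assume "sep_cone a b \<sigma>"
  then have tr: "0 \<le> Re (mtrace \<sigma>)" by (rule psd_mtrace(2)[OF sep_cone_psd])
  show "disc_run dA dB a b \<rho>0 \<rho>1 L thr 0 h \<sigma> c \<le> exp (t * (real c - thr)) * Re (mtrace \<sigma>)"
  proof (cases "thr \<le> real c")
    case True
    then have "1 \<le> exp (t * (real c - thr))" using assms(5) by simp
    from mult_right_mono[OF this tr] show ?thesis using True by simp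
  qed (use tr in simp)
next
  fix h x K z \<sigma> assume "sep_cone a b \<sigma>" "(x, K) \<in> set (L h)"
  then show "sep_cone a b (K * bstate dA dB a b (sent z) \<sigma> * adj K)"
    by (intro sep_cone_LOCC[OF assms(1)] sep_cone_bstate sent(1))
next
  fix h z \<sigma> assume "sep_cone a b \<sigma>"
  then show "outcome_prob (L h) (\<lambda>_. True) (bstate dA dB a b (sent z) \<sigma>) = Re (mtrace \<sigma>)"
    by (intro outcome_prob_bstate[OF assms(1)] sep_cone_carrier)
next
  fix h \<sigma> assume "sep_cone a b \<sigma>"
  from success_prob_separable_memory[OF assms(1-3) this]
  show "(exp t - 1) * success_prob (L h) (bstate dA dB a b (sent False) \<sigma>) (bstate dA dB a b (sent True) \<sigma>)
    \<le> (exp t - 1) * (P_LOCC dA dB \<rho>0 \<rho>1 * Re (mtrace \<sigma>))"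
    using assms(5) by (auto intro!: mult_left_mono)
next
  show "0 \<le> 1 + P_LOCC dA dB \<rho>0 \<rho>1 * (exp t - 1)"
    using P_LOCC_bounds by (intro moment_factor_nonneg) auto
qed (use assms(4) in simp_all)

lemma memory_rate_le:
  assumes "\<And>h. LOCC (dA * a) (dB * b) a b (L h)" "0 < a" "0 < b" "density (a * b) \<mu>" "r \<le> 1"
    and "achievable (succ_prob dA dB a b \<rho>0 \<rho>1 L \<mu> r)"
  shows "r \<le> P_LOCC dA dB \<rho>0 \<rho>1"
proof (rule ccontr)
  let ?P = "P_LOCC dA dB \<rho>0 \<rho>1"
  assume "\<not> r \<le> ?P"
  then have r: "?P < r" by simp
  define t where "t = (r - ?P) / 2"
  have t: "0 \<le> t" using r by (simp add: t_def)
  define x where "x = exp (- ((r - ?P)\<^sup>2 / 4))"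
  have x: "0 \<le> x" "x < 1" using r by (auto simp: x_def)
  \<comment> \<open>The factor \<open>a * b\<close> is the trace of the identity, the price of
    dominating \<open>\<mu>\<close>; the geometric factor outweighs it for large
    \<open>n\<close>.\<close>
  have bound: "succ_prob dA dB a b \<rho>0 \<rho>1 L \<mu> r n \<le> x ^ n * real (a * b)" for n
  proof -
    have "succ_prob dA dB a b \<rho>0 \<rho>1 L \<mu> r n \<le> disc_run dA dB a b \<rho>0 \<rho>1 L (r * real n) n [] (1\<^sub>m (a * b)) 0"
      unfolding succ_prob_def by (rule disc_run_le_uniform_memory[OF assms(1,4)])
    also have "\<dots> \<le> exp (t * (real 0 - r * real n)) * (1 + ?P * (exp t - 1)) ^ n * Re (mtrace (1\<^sub>m (a * b)))"
      by (rule disc_run_separable_memory[OF assms(1-3) sep_cone_one t])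
    also have "\<dots> \<le> x ^ n * real (a * b)"
    proof (rule mult_mono)
      show "exp (t * (real 0 - r * real n)) * (1 + ?P * (exp t - 1)) ^ n \<le> x ^ n"
        using chernoff_power[of ?P r t n] P_LOCC_bounds assms(5) by (simp add: t_def x_def)
      show "Re (mtrace (1\<^sub>m (a * b))) \<le> real (a * b)" by (simp add: mtrace_def)
    qed (use x in \<open>auto simp: mtrace_def\<close>)
    finally show ?thesis .
  qed
  have "(\<lambda>n. x ^ n * real (a * b)) \<longlonglongrightarrow> 0"
    using x by (intro tendsto_mult_left_zero LIMSEQ_power_zero) auto
  then have "eventually (\<lambda>n. x ^ n * real (a * b) < 1/2) sequentially"
    by (rule order_tendstoD) simp
  then obtain N where N: "\<And>n. n \<ge> N \<Longrightarrow> x ^ n * real (a * b) < 1/2"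
    unfolding eventually_sequentially by blast
  \<comment> \<open>Achievability with error 1/2 supplies some \<open>n\<close> beyond every
    \<open>N\<close>, in particular one where the bound is already below 1/2.\<close>
  obtain n where "n \<ge> N" "succ_prob dA dB a b \<rho>0 \<rho>1 L \<mu> r n \<ge> 1 - 1/2"
    using assms(6)[unfolded achievable_def, rule_format, of "1/2" N] by auto
  then show False using N[of n] bound[of n] by linarith
qed

section \<open>The trivial catalyst and the lower bound on the rate\<close>

lemma cat_round_trivial:
  assumes "LOCC dA dB 1 1 M"
  shows "cat_round dA dB 1 1 [(0, 1\<^sub>m (dA * 1 * (dB * 1)))] M = M"
proof -
  have "btensor 1 1 dA dB 1 1 1 1 K (1\<^sub>m 1) * 1\<^sub>m (dA * dB) = K" if "(x, K) \<in> set M" for x K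
    using LOCC_carrier[OF assms that] by (simp add: btensor_one_right)
  then show ?thesis by (auto simp: cat_round_def intro!: map_idI)
qed

lemma psd_scalar:
  assumes "psd 1 \<sigma>"
  shows "\<sigma> = complex_of_real (Re (mtrace \<sigma>)) \<cdot>\<^sub>m 1\<^sub>m 1"
proof -
  have "\<sigma> \<in> carrier_mat 1 1" using assms by (rule psd_carrier)
  moreover from this have "mtrace \<sigma> = \<sigma> $$ (0, 0)" by (simp add: mtrace_def One_nat_def)
  ultimately show ?thesis using psd_mtrace(3)[OF assms] by (intro eq_matI) auto
qed

lemma success_prob_trivial_memory:
  fixes M :: "((bool \<times> nat) \<times> complex mat) list"
  assumes "LOCC dA dB 1 1 M" "psd 1 \<sigma>"
  shows "success_prob M (bstate dA dB 1 1 \<rho>0 \<sigma>) (bstate dA dB 1 1 \<rho>1 \<sigma>) = success_prob M \<rho>0 \<rho>1 * Re (mtrace \<sigma>)"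
proof -
  have "bstate dA dB 1 1 X \<sigma> = complex_of_real (Re (mtrace \<sigma>)) \<cdot>\<^sub>m X"
    if "X \<in> carrier_mat (dA * dB) (dA * dB)" for X
  proof -
    have "bstate dA dB 1 1 X (complex_of_real s \<cdot>\<^sub>m 1\<^sub>m 1) = complex_of_real s \<cdot>\<^sub>m X" for s
      using btensor_smult_right[of "1\<^sub>m 1" 1 1 1 1] btensor_one_right[OF that] by simp
    then show ?thesis using psd_scalar[OF assms(2)] by metis
  qed
  then show ?thesis
    using outcome_prob_smult[OF LOCC_carriers[OF assms(1)]] carrier
    by (simp add: success_prob_def field_simps)
qed

text \<open>The moment estimate is applied to the failure weight, the total weight minus the weight
  of reaching the threshold. For \<open>t \<le> 0\<close> the exponential dominates the indicator of
  \<open>real c < thr\<close>. The memory is a nonnegative scalar, so the one-round hypothesis holds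
  with equality.\<close>

lemma disc_run_trivial_memory:
  fixes M :: "((bool \<times> nat) \<times> complex mat) list"
  assumes M: "LOCC dA dB 1 1 M" and "psd 1 \<sigma>" "t \<le> 0"
  shows "Re (mtrace \<sigma>) - disc_run dA dB 1 1 \<rho>0 \<rho>1 (\<lambda>_. M) thr m h \<sigma> c \<le>
    exp (t * (real c - thr)) * (1 + success_prob M \<rho>0 \<rho>1 * (exp t - 1)) ^ m * Re (mtrace \<sigma>)"
proof -
  have L: "LOCC (dA * 1) (dB * 1) 1 1 M" using M by simp
  show ?thesis
  proof (rule exp_moment_bound[where Cone="psd 1" and B="\<lambda>z. bstate dA dB 1 1 (sent z)" and L="\<lambda>_. M"
      and f="\<lambda>m h \<sigma> c. Re (mtrace \<sigma>) - disc_run dA dB 1 1 \<rho>0 \<rho>1 (\<lambda>_. M) thr m h \<sigma> c"])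
    fix \<sigma> c assume "psd 1 \<sigma>"
    then have tr: "0 \<le> Re (mtrace \<sigma>)" by (rule psd_mtrace(2))
    show "Re (mtrace \<sigma>) - disc_run dA dB 1 1 \<rho>0 \<rho>1 (\<lambda>_. M) thr 0 h \<sigma> c
        \<le> exp (t * (real c - thr)) * Re (mtrace \<sigma>)" for h
    proof (cases "thr \<le> real c")
      case False
      then have "1 \<le> exp (t * (real c - thr))" using assms(3) by (simp add: mult_nonpos_nonpos)
      from mult_right_mono[OF this tr] show ?thesis using False by simp
    qed (use tr in simp)
  next
    have tp: "outcome_prob M (\<lambda>_. True) (bstate dA dB 1 1 (sent z) \<sigma>) = Re (mtrace \<sigma>)"
      if "psd 1 \<sigma>" for z \<sigma>
      using psd_carrier[OF that] by (intro outcome_prob_bstate[OF L]) simp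
    then show "outcome_prob M (\<lambda>_. True) (bstate dA dB 1 1 (sent z) \<sigma>) = Re (mtrace \<sigma>)"
      if "psd 1 \<sigma>" for z \<sigma> using that .
    fix m h \<sigma> c assume \<sigma>: "psd 1 \<sigma>"
    let ?D = "disc_run dA dB 1 1 \<rho>0 \<rho>1 (\<lambda>_. M) thr m"
    \<comment> \<open>A round preserves the total weight, so it expands along the same branches as
      \<open>disc_run\<close>, and the failure weight inherits the recursion.\<close>
    have "Re (mtrace \<sigma>) = (\<Sum>z\<in>UNIV. 1/2 * (\<Sum>(x, K)\<leftarrow>M. Re (mtrace (K * bstate dA dB 1 1 (sent z) \<sigma> * adj K))))"
      using tp[OF \<sigma>] unfolding outcome_prob_def by (simp add: UNIV_bool)
    then show "Re (mtrace \<sigma>) - disc_run dA dB 1 1 \<rho>0 \<rho>1 (\<lambda>_. M) thr (Suc m) h \<sigma> c =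
      (\<Sum>z\<in>UNIV. 1/2 * (\<Sum>(x, K)\<leftarrow>M. Re (mtrace (K * bstate dA dB 1 1 (sent z) \<sigma> * adj K)) -
        ?D (h @ [x]) (K * bstate dA dB 1 1 (sent z) \<sigma> * adj K) (if fst x = z then Suc c else c)))"
      unfolding disc_run.simps
      by (simp only: sum_subtractf[symmetric] right_diff_distrib[symmetric] sum_list_subtractf[symmetric] case_prod_unfold)
  next
    fix x K z \<sigma> assume "psd 1 \<sigma>" "(x, K) \<in> set M"
    then show "psd 1 (K * bstate dA dB 1 1 (sent z) \<sigma> * adj K)"
      using psd_conj[OF psd_bstate[OF sent(1), of 1 1 \<sigma> z] LOCC_carrier[OF L]] by simp
  next
    fix \<sigma> assume "psd 1 \<sigma>"
    from success_prob_trivial_memory[OF M this]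
    show "(exp t - 1) * success_prob M (bstate dA dB 1 1 (sent False) \<sigma>) (bstate dA dB 1 1 (sent True) \<sigma>)
      \<le> (exp t - 1) * (success_prob M \<rho>0 \<rho>1 * Re (mtrace \<sigma>))"
      by simp
  next
    show "0 \<le> 1 + success_prob M \<rho>0 \<rho>1 * (exp t - 1)"
    proof (rule moment_factor_nonneg)
      show "success_prob M \<rho>0 \<rho>1 \<le> 1" using success_prob_le_1[OF M] .
      show "0 \<le> success_prob M \<rho>0 \<rho>1"
        unfolding success_prob_def
        using outcome_prob_nonneg[OF LOCC_carriers[OF M]] sep_cone_psd[OF sep(1)] sep_cone_psd[OF sep(2)]
        by simp
    qed
  qed (rule assms(2))
qed

lemma trivial_memory_achievable:
  fixes M :: "((bool \<times> nat) \<times> complex mat) list"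
  assumes M: "LOCC dA dB 1 1 M" and r: "0 \<le> r" "r < success_prob M \<rho>0 \<rho>1"
  shows "achievable (succ_prob dA dB 1 1 \<rho>0 \<rho>1 (\<lambda>_. M) (1\<^sub>m 1) r)"
proof -
  let ?p = "success_prob M \<rho>0 \<rho>1"
  define t where "t = (r - ?p) / 2"
  define x where "x = exp (- ((r - ?p)\<^sup>2 / 4))"
  have x: "0 \<le> x" "x < 1" using r by (auto simp: x_def)
  have p: "0 \<le> ?p" "?p \<le> 1" using r success_prob_le_1[OF M] by auto
  have bound: "1 - x ^ n \<le> succ_prob dA dB 1 1 \<rho>0 \<rho>1 (\<lambda>_. M) (1\<^sub>m 1) r n" for n
  proof -
    have "t \<le> 0" using r by (simp add: t_def)
    from disc_run_trivial_memory[OF M psd_one this, of "r * real n" n "[]" 0]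
    have "1 - succ_prob dA dB 1 1 \<rho>0 \<rho>1 (\<lambda>_. M) (1\<^sub>m 1) r n \<le>
        exp (t * (0 - r * real n)) * (1 + ?p * (exp t - 1)) ^ n"
      by (simp add: succ_prob_def mtrace_def)
    also have "\<dots> \<le> x ^ n"
      unfolding x_def using p r by (intro chernoff_power) (auto simp: t_def)
    finally show ?thesis by simp
  qed
  have lim: "(\<lambda>n. x ^ n) \<longlonglongrightarrow> 0" using x by (intro LIMSEQ_power_zero) auto
  show ?thesis
    unfolding achievable_def
  proof (intro allI impI)
    fix \<epsilon> :: real and m :: nat assume "0 < \<epsilon>"
    with lim have "eventually (\<lambda>n. x ^ n < \<epsilon>) sequentially" by (rule order_tendstoD)
    then obtain N where "\<And>n. n \<ge> N \<Longrightarrow> x ^ n < \<epsilon>" unfolding eventually_sequentially by blast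
    then have "1 - \<epsilon> \<le> succ_prob dA dB 1 1 \<rho>0 \<rho>1 (\<lambda>_. M) (1\<^sub>m 1) r (max m N)"
      using bound[of "max m N"] by (smt (verit) max.cobounded2)
    then show "\<exists>n\<ge>m. 1 - \<epsilon> \<le> succ_prob dA dB 1 1 \<rho>0 \<rho>1 (\<lambda>_. M) (1\<^sub>m 1) r n"
      by (intro exI[of _ "max m N"]) simp
  qed
qed

text \<open>The set whose supremum is \<open>R_m\<close>, named so that it can be compared with its
  catalytic counterpart.\<close>

definition memory_rates :: "real set" where
  "memory_rates = {r. 0 \<le> r \<and> r \<le> 1 \<and>
     (\<exists>dA' dB' \<mu> L. 0 < dA' \<and> 0 < dB' \<and> density (dA' * dB') \<mu> \<and>
        (\<forall>h. LOCC (dA * dA') (dB * dB') dA' dB' (L h)) \<and>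
        achievable (succ_prob dA dB dA' dB' \<rho>0 \<rho>1 L \<mu> r))}"

definition catalytic_rates :: "real set" where
  "catalytic_rates = {r. 0 \<le> r \<and> r \<le> 1 \<and>
     (\<exists>dA' dB' \<tau> (Lam :: (nat \<times> complex mat) list) \<sigma>0 \<sigma>1 M.
        0 < dA' \<and> 0 < dB' \<and> density (dA' * dB') \<tau> \<and>
        LOCC (dA * dA') (dB * dB') (dA * dA') (dB * dB') Lam \<and>
        density (dA * dB) \<sigma>0 \<and> density (dA * dB) \<sigma>1 \<and>
        chan (dA * dA' * (dB * dB')) Lam (bstate dA dB dA' dB' \<rho>0 \<tau>) = bstate dA dB dA' dB' \<sigma>0 \<tau> \<and>
        chan (dA * dA' * (dB * dB')) Lam (bstate dA dB dA' dB' \<rho>1 \<tau>) = bstate dA dB dA' dB' \<sigma>1 \<tau> \<and>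
        LOCC dA dB 1 1 M \<and>
        achievable (succ_prob dA dB dA' dB' \<rho>0 \<rho>1 (\<lambda>_. cat_round dA dB dA' dB' Lam M) \<tau> r))}"

lemma memory_rates_le: "r \<in> memory_rates \<Longrightarrow> r \<le> P_LOCC dA dB \<rho>0 \<rho>1"
  unfolding memory_rates_def using memory_rate_le by blast

lemma memory_ratesI:
  assumes "0 \<le> r" "r \<le> 1" "0 < a" "0 < b" "density (a * b) \<mu>"
    "\<And>h. LOCC (dA * a) (dB * b) a b (L h)" "achievable (succ_prob dA dB a b \<rho>0 \<rho>1 L \<mu> r)"
  shows "r \<in> memory_rates"
  unfolding memory_rates_def using assms by blast

lemma catalytic_rates_subset: "catalytic_rates \<subseteq> memory_rates"
proof
  fix r assume "r \<in> catalytic_rates"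
  then obtain a b \<tau> M and Lam :: "(nat \<times> complex mat) list" where
    r: "0 \<le> r" "r \<le> 1" and ab: "0 < a" "0 < b" "density (a * b) \<tau>"
    and Lam: "LOCC (dA * a) (dB * b) (dA * a) (dB * b) Lam" and M: "LOCC dA dB 1 1 M"
    and ach: "achievable (succ_prob dA dB a b \<rho>0 \<rho>1 (\<lambda>_. cat_round dA dB a b Lam M) \<tau> r)"
    unfolding catalytic_rates_def by blast
  show "r \<in> memory_rates"
    by (rule memory_ratesI[OF r ab cat_round_LOCC[OF Lam M] ach])
qed

lemma catalytic_rates_lower:
  assumes "0 \<le> r" "r < P_LOCC dA dB \<rho>0 \<rho>1"
  shows "r \<in> catalytic_rates"
proof -
  obtain M :: "((bool \<times> nat) \<times> complex mat) list"
    where M: "LOCC dA dB 1 1 M" "r < success_prob M \<rho>0 \<rho>1"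
    using P_LOCC_approx[OF assms(2)] .
  \<comment> \<open>The identity channel with a one-dimensional catalyst: the catalyst is returned,
    and the output states are \<open>\<rho>0\<close> and \<open>\<rho>1\<close> themselves.\<close>
  let ?Lam = "[(0, 1\<^sub>m (dA * 1 * (dB * 1)))] :: (nat \<times> complex mat) list"
  have dens: "density (dA * dB) \<rho>0" "density (dA * dB) \<rho>1" "density (1 * 1) (1\<^sub>m 1)"
    using sep_cone_psd[OF sep(1)] sep_cone_psd[OF sep(2)] unit_trace psd_one[of 1]
    by (simp_all add: density_def mtrace_def)
  have chan: "chan (dA * 1 * (dB * 1)) ?Lam (bstate dA dB 1 1 X (1\<^sub>m 1)) = bstate dA dB 1 1 X (1\<^sub>m 1)" for X
  proof -
    have "bstate dA dB 1 1 X (1\<^sub>m 1) \<in> carrier_mat (dA * 1 * (dB * 1)) (dA * 1 * (dB * 1))"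
      by (rule btensor_carrier)
    then show ?thesis by (simp add: chan_def)
  qed
  have "LOCC (dA * 1) (dB * 1) (dA * 1) (dB * 1) ?Lam" by (rule LOCC.finish)
  moreover have "achievable (succ_prob dA dB 1 1 \<rho>0 \<rho>1 (\<lambda>_. cat_round dA dB 1 1 ?Lam M) (1\<^sub>m 1) r)"
    unfolding cat_round_trivial[OF M(1)] by (rule trivial_memory_achievable[OF M(1) assms(1) M(2)])
  moreover have "r \<le> 1" using assms P_LOCC_bounds by simp
  moreover have one: "0 < (1 :: nat)" by simp
  ultimately show ?thesis
    unfolding catalytic_rates_def using assms(1) dens chan M(1) one by blast
qed

lemma rates_eq:
  "R_m dA dB \<rho>0 \<rho>1 = P_LOCC dA dB \<rho>0 \<rho>1" "R_c dA dB \<rho>0 \<rho>1 = P_LOCC dA dB \<rho>0 \<rho>1"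
proof -
  \<comment> \<open>One squeeze serves both suprema: such an \<open>S\<close> contains every
    nonnegative rate below \<open>P_LOCC\<close> and none above it, whether or not
    \<open>P_LOCC\<close> itself is attained. It is nonempty since \<open>P_LOCC\<close> is at least
    1/2.\<close>
  have sup: "Sup S = P_LOCC dA dB \<rho>0 \<rho>1" if "catalytic_rates \<subseteq> S" "S \<subseteq> memory_rates" for S
  proof (rule antisym)
    have lower: "r \<in> S" if "0 \<le> r" "r < P_LOCC dA dB \<rho>0 \<rho>1" for r
      using catalytic_rates_lower[OF that] \<open>catalytic_rates \<subseteq> S\<close> by blast
    have upper: "r \<le> P_LOCC dA dB \<rho>0 \<rho>1" if "r \<in> S" for r
      using memory_rates_le that \<open>S \<subseteq> memory_rates\<close> by blast
    have "0 \<in> S" using lower[of 0] P_LOCC_bounds by simp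
    then show "Sup S \<le> P_LOCC dA dB \<rho>0 \<rho>1" using upper by (intro cSup_least) auto
    have bdd: "bdd_above S" using upper by (rule bdd_aboveI)
    show "P_LOCC dA dB \<rho>0 \<rho>1 \<le> Sup S"
    proof (rule dense_le_bounded[of 0])
      show "0 < P_LOCC dA dB \<rho>0 \<rho>1" using P_LOCC_bounds by simp
      show "r \<le> Sup S" if "0 < r" "r < P_LOCC dA dB \<rho>0 \<rho>1" for r
        using lower that by (intro cSup_upper[OF _ bdd]) auto
    qed
  qed
  show "R_m dA dB \<rho>0 \<rho>1 = P_LOCC dA dB \<rho>0 \<rho>1"
    unfolding R_m_def memory_rates_def[symmetric] by (rule sup[OF catalytic_rates_subset order_refl])
  show "R_c dA dB \<rho>0 \<rho>1 = P_LOCC dA dB \<rho>0 \<rho>1"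
    unfolding R_c_def catalytic_rates_def[symmetric] by (rule sup[OF order_refl catalytic_rates_subset])
qed

end

theorem theorem1:
  fixes dA dB :: nat and \<rho>0 \<rho>1 :: "complex mat"
  assumes "0 < dA" and "0 < dB"
    and "SEP dA dB \<rho>0" and "SEP dA dB \<rho>1"
  shows "R_m dA dB \<rho>0 \<rho>1 = P_LOCC dA dB \<rho>0 \<rho>1 \<and> R_c dA dB \<rho>0 \<rho>1 = P_LOCC dA dB \<rho>0 \<rho>1"
proof -
  interpret separable_pair dA dB \<rho>0 \<rho>1
    using assms by unfold_locales (auto intro: SEP_sep_cone)
  show ?thesis using rates_eq by blast
qed

end
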